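(* There exists a function $f:\mathbb{Z}_{>0}\to\mathbb{Z}_{>0}$ with the following property. Let $n$ be a positive integer and let $G$ be a group such that $|x^{G'}|\leq n$ for every commutator $x\in G$. Then $\gamma_3(G')$ is finite and $|\gamma_3(G')|\leq f(n)$.
   Context: Groups are arbitrary (not assumed finite). For elements $x_1,x_2$ of a group, $[x_1,x_2]=x_1^{-1}x_2^{-1}x_1x_2$. An element $x\in G$ is called a commutator if $x=[x_1,x_2]$ for some $x_1,x_2\in G$ (a single commutator, not a product of several). $G'$ denotes the derived group of $G$ (the subgroup generated by all commutators). $x^{G'}=\{g^{-1}xg : g\in G'\}$ is the set of conjugates of $x$ by elements of $G'$. $\gamma_3(G')$ is the third term of the lower central series of $G'$, i.e. $\gamma_3(G')=[[G',G'],G']$. *)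

theory Defs
  imports "HOL-Algebra.Generated_Groups"
begin

definition commutator :: "('a, 'b) monoid_scheme \<Rightarrow> 'a \<Rightarrow> 'a \<Rightarrow> 'a" where
  "commutator G x y = inv\<^bsub>G\<^esub> x \<otimes>\<^bsub>G\<^esub> inv\<^bsub>G\<^esub> y \<otimes>\<^bsub>G\<^esub> x \<otimes>\<^bsub>G\<^esub> y"

definition commutators :: "('a, 'b) monoid_scheme \<Rightarrow> 'a set" where
  "commutators G = {commutator G x y | x y. x \<in> carrier G \<and> y \<in> carrier G}"

definition conjugates :: "('a, 'b) monoid_scheme \<Rightarrow> 'a set \<Rightarrow> 'a \<Rightarrow> 'a set" where
  "conjugates G H x = {inv\<^bsub>G\<^esub> g \<otimes>\<^bsub>G\<^esub> x \<otimes>\<^bsub>G\<^esub> g | g. g \<in> H}"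

definition commutator_subgroup ::
    "('a, 'b) monoid_scheme \<Rightarrow> 'a set \<Rightarrow> 'a set \<Rightarrow> 'a set" where
  "commutator_subgroup G H K = generate G {commutator G h k | h k. h \<in> H \<and> k \<in> K}"

text \<open>
  The lower central series of a subgroup \<open>H\<close> of \<open>G\<close>, numbered from 1:
  \<open>\<gamma>\<^sub>1(H) = H\<close> and \<open>\<gamma>\<^sub>k\<^sub>+\<^sub>1(H) = [\<gamma>\<^sub>k(H), H]\<close>. The value at \<open>k = 0\<close> is immaterial.
\<close>
definition lower_central ::
    "('a, 'b) monoid_scheme \<Rightarrow> 'a set \<Rightarrow> nat \<Rightarrow> 'a set" where
  "lower_central G H k = ((\<lambda>K. commutator_subgroup G K H) ^^ (k - 1)) H"

text \<open>
  The library's \<open>derived\<close> is generated by the elements \<open>x y x\<inverse> y\<inverse>\<close>. These are the commutators of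
  \<open>x\<inverse>\<close> and \<open>y\<inverse>\<close> in the present convention, so the subgroup is the same.
\<close>
abbreviation derived_group :: "('a, 'b) monoid_scheme \<Rightarrow> 'a set" where
  "derived_group G \<equiv> derived G (carrier G)"

text \<open>
  The bounding function has to be the same for all groups, whatever the type of their elements.
  HOL has no quantification over types inside a formula: in \<open>\<exists>f. \<forall>G :: 'a monoid. \<dots>\<close> the function
  could depend on \<open>'a\<close>. The theorem therefore asks for an \<open>f\<close> that equals a constant
  whose definition mentions no type variable: an arbitrary function that works for the groups
  with elements in \<open>nat\<close>, if there is one. Nothing is lost by this choice. If \<open>f\<close> works for the
  countable groups, then it works for all groups: the hypothesis passes to subgroups, and more than
  \<open>f n\<close> elements of \<open>\<gamma>\<^sub>3(G')\<close> would already be in \<open>\<gamma>\<^sub>3(H')\<close> for a finitely generated \<open>H\<close>.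
\<close>
definition gamma3_bound :: "nat \<Rightarrow> nat" where
  "gamma3_bound = (SOME f.
     (\<forall>n>0. f n > 0) \<and>
     (\<forall>n>0. \<forall>G :: nat monoid. group G \<longrightarrow>
        (\<forall>x \<in> commutators G. finite (conjugates G (derived_group G) x) \<and>
           card (conjugates G (derived_group G) x) \<le> n) \<longrightarrow>
        finite (lower_central G (derived_group G) 3) \<and>
        card (lower_central G (derived_group G) 3) \<le> f n))"

end

theory Submission
  imports Defs "HOL-Library.Countable_Set" "HOL-Algebra.Zassenhaus" "HOL-Algebra.Weak_Morphisms"
begin

text \<open>
  Put \<open>H = G'\<close>; it is generated by the set \<open>Y\<close> of commutators of \<open>G\<close>, each of which has at most
  \<open>n\<close> conjugates under \<open>H\<close>. For \<open>y \<in> Y\<close>, every coset of the centralizer of \<open>y\<close> contains a product of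
  fewer than \<open>n\<close> elements of \<open>Y\<close>, so \<open>[y, H]\<close> lies in the derived subgroup of the normal subgroup
  generated by boundedly many conjugates of elements of \<open>Y\<close>. That subgroup is central-by-finite, and
  Schur's theorem bounds its derived subgroup.

  Now let \<open>a = [d, e]\<close> with \<open>d, e \<in> H\<close> have the largest class, and let the normal subgroup \<open>U\<close> of
  bounded index centralize short words conjugating \<open>a\<close> to all its conjugates. If \<open>u \<in> U\<close> and \<open>u a\<close> is
  again a commutator, then maximality forces \<open>(u a)\<^sup>H = u a\<^sup>H\<close>, so \<open>u\<close> is central modulo the finite
  normal subgroup obtained for \<open>a\<close>. Applied to \<open>[u\<^sub>1 d, e]\<close>, \<open>[d, u\<^sub>2 e]\<close> and \<open>[u\<^sub>1 d, u\<^sub>2 e]\<close> this makes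
  \<open>[U, U]\<close> central. Since \<open>H\<close> is generated by \<open>U\<close> and boundedly many elements of \<open>Y\<close>, which are central
  modulo finite normal subgroups too, \<open>H'\<close> is central modulo a finite normal subgroup of bounded order.
\<close>

section \<open>Conjugation and words\<close>

definition conj_by :: "('a, 'b) monoid_scheme \<Rightarrow> 'a \<Rightarrow> 'a \<Rightarrow> 'a" where
  "conj_by G g x = inv\<^bsub>G\<^esub> g \<otimes>\<^bsub>G\<^esub> x \<otimes>\<^bsub>G\<^esub> g"

definition word_prod :: "('a, 'b) monoid_scheme \<Rightarrow> 'a list \<Rightarrow> 'a" where
  "word_prod G w = foldr (mult G) w \<one>\<^bsub>G\<^esub>"

context group
begin

lemma inv_mult_cancel:
  assumes "x \<in> carrier G" "y \<in> carrier G"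
  shows "inv x \<otimes> (x \<otimes> y) = y" "x \<otimes> (inv x \<otimes> y) = y"
  using assms by (simp_all flip: m_assoc)

text \<open>Oriented as rewrite rules these form a confluent system, so \<open>simp\<close> decides identities in free groups.\<close>

lemmas free_group_simps = m_assoc inv_mult_group inv_mult_cancel conj_by_def commutator_def

lemma commutator_closed [simp, intro]:
  "x \<in> carrier G \<Longrightarrow> y \<in> carrier G \<Longrightarrow> commutator G x y \<in> carrier G"
  by (simp add: commutator_def)

lemma conj_by_closed [simp, intro]:
  "g \<in> carrier G \<Longrightarrow> x \<in> carrier G \<Longrightarrow> conj_by G g x \<in> carrier G"
  by (simp add: conj_by_def)

lemma conj_by_mult:
  assumes "g \<in> carrier G" "x \<in> carrier G" "y \<in> carrier G"
  shows "conj_by G g (x \<otimes> y) = conj_by G g x \<otimes> conj_by G g y"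
  using assms by (simp add: free_group_simps)

lemma conj_by_one: "g \<in> carrier G \<Longrightarrow> conj_by G g \<one> = \<one>"
  by (simp add: conj_by_def)

lemma conj_by_conj_by:
  assumes "g \<in> carrier G" "h \<in> carrier G" "x \<in> carrier G"
  shows "conj_by G h (conj_by G g x) = conj_by G (g \<otimes> h) x"
  using assms by (simp add: free_group_simps)

lemma conj_by_commutator:
  assumes "g \<in> carrier G" "x \<in> carrier G" "y \<in> carrier G"
  shows "conj_by G g (commutator G x y) = commutator G (conj_by G g x) (conj_by G g y)"
  using assms by (simp add: free_group_simps)

lemma conj_by_eq_self_iff:
  assumes "g \<in> carrier G" "x \<in> carrier G"
  shows "conj_by G g x = x \<longleftrightarrow> g \<otimes> x = x \<otimes> g"
  using assms by (auto simp: conj_by_def m_assoc inv_solve_left')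

lemma inv_commutator:
  assumes "x \<in> carrier G" "y \<in> carrier G"
  shows "inv (commutator G x y) = commutator G y x"
  using assms by (simp add: free_group_simps)

lemma conj_by_normal: "N \<lhd> G \<Longrightarrow> g \<in> carrier G \<Longrightarrow> x \<in> N \<Longrightarrow> conj_by G g x \<in> N"
  unfolding conj_by_def by (rule normal.inv_op_closed1)

lemma normal_conj_byI:
  assumes "subgroup N G" "\<And>g x. g \<in> carrier G \<Longrightarrow> x \<in> N \<Longrightarrow> conj_by G g x \<in> N"
  shows "N \<lhd> G"
proof -
  have "x \<otimes> h \<otimes> inv x \<in> N" if "x \<in> carrier G" "h \<in> N" for x h
    using assms(2)[of "inv x" h] that by (simp add: conj_by_def)
  then show ?thesis using assms(1) by (auto simp: normal_inv_iff)
qed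

lemma conjugates_altdef: "conjugates G H x = (\<lambda>g. conj_by G g x) ` H"
  by (auto simp: conjugates_def conj_by_def)

lemma derived_eq_commutator_subgroup:
  assumes "subgroup H G"
  shows "derived G H = commutator_subgroup G H H"
proof -
  interpret H: subgroup H G by fact
  have "derived_set G H = {commutator G h k | h k. h \<in> H \<and> k \<in> H}" (is "?A = ?B")
  proof
    show "?A \<subseteq> ?B"
    proof clarify
      fix h k assume "h \<in> H" "k \<in> H"
      then show "\<exists>h' k'. h \<otimes> k \<otimes> inv h \<otimes> inv k = commutator G h' k' \<and> h' \<in> H \<and> k' \<in> H"
        by (intro exI[of _ "inv h"] exI[of _ "inv k"]) (simp add: commutator_def)
    qed
    show "?B \<subseteq> ?A"
    proof clarify
      fix h k assume "h \<in> H" "k \<in> H"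
      then show "commutator G h k \<in> ?A"
        by (intro UN_I[of "inv h"] UN_I[of "inv k"]) (simp_all add: commutator_def)
    qed
  qed
  then show ?thesis by (simp add: derived_def commutator_subgroup_def)
qed

lemma commutator_in_derived:
  assumes "subgroup H G" "x \<in> H" "y \<in> H"
  shows "commutator G x y \<in> derived G H"
  unfolding derived_eq_commutator_subgroup[OF assms(1)] commutator_subgroup_def
  using assms by (intro generate.incl) auto

section \<open>Words over a generating set closed under inversion\<close>

lemma word_prod_Nil [simp]: "word_prod G [] = \<one>"
  by (simp add: word_prod_def)

lemma word_prod_Cons [simp]: "word_prod G (x # w) = x \<otimes> word_prod G w"
  by (simp add: word_prod_def)

lemma word_prod_in_subgroup:
  assumes "subgroup H G" "set w \<subseteq> H"
  shows "word_prod G w \<in> H"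
  using assms(2) by (induction w) (auto simp: assms(1) subgroup.one_closed subgroup.m_closed)

lemma word_prod_closed [simp]: "set w \<subseteq> carrier G \<Longrightarrow> word_prod G w \<in> carrier G"
  by (rule word_prod_in_subgroup[OF subgroup_self])

lemma word_prod_append [simp]:
  "set u \<subseteq> carrier G \<Longrightarrow> set v \<subseteq> carrier G \<Longrightarrow> word_prod G (u @ v) = word_prod G u \<otimes> word_prod G v"
  by (induction u) (auto simp: m_assoc)

lemma word_prod_replicate:
  "x \<in> carrier G \<Longrightarrow> word_prod G (replicate n x) = x [^] n"
  by (induction n) (simp_all flip: nat_pow_Suc2)

lemma word_prod_map_conj_by:
  assumes "g \<in> carrier G" "set w \<subseteq> carrier G"
  shows "word_prod G (map (conj_by G g) w) = conj_by G g (word_prod G w)"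
  using assms(2) by (induction w) (auto simp: assms(1) conj_by_one conj_by_mult)

text \<open>Inverses of letters are letters again, so plain words suffice, and a word of least
  length can be chosen for an element; the later counting arguments rest on this.\<close>

lemma generate_eq_word_prod:
  assumes Y: "Y \<subseteq> carrier G" and sym: "\<And>y. y \<in> Y \<Longrightarrow> inv y \<in> Y"
  shows "generate G Y = word_prod G ` {w. set w \<subseteq> Y}"
proof (intro equalityI subsetI)
  fix h assume "h \<in> generate G Y"
  then show "h \<in> word_prod G ` {w. set w \<subseteq> Y}"
  proof induction
    case one
    then show ?case by (intro image_eqI[of _ _ "[]"]) auto
  next
    case (incl h)
    then show ?case using Y by (intro image_eqI[of _ _ "[h]"]) auto
  next
    case (inv h)
    then show ?case using Y sym by (intro image_eqI[of _ _ "[inv h]"]) auto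
  next
    case (eng h1 h2)
    then obtain u v where "set u \<subseteq> Y" "set v \<subseteq> Y" "h1 = word_prod G u" "h2 = word_prod G v" by auto
    then show ?case using Y by (intro image_eqI[of _ _ "u @ v"]) auto
  qed
next
  fix h assume "h \<in> word_prod G ` {w. set w \<subseteq> Y}"
  then obtain w where "set w \<subseteq> Y" "h = word_prod G w" by auto
  moreover from this have "set w \<subseteq> generate G Y" by (auto intro: generate.incl)
  ultimately show "h \<in> generate G Y"
    using word_prod_in_subgroup generate_is_subgroup[OF Y] by blast
qed

text \<open>
  If two prefixes of a word have the same image, the part between them can be cut out;
  hence the prefixes of a shortest word have pairwise distinct images.
\<close>

lemma short_word_exists:
  assumes Y: "Y \<subseteq> carrier G" "\<And>y. y \<in> Y \<Longrightarrow> inv y \<in> Y"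
    and gen: "generate G Y = carrier G"
    and fin: "finite F" "\<phi> ` carrier G \<subseteq> F"
    and comp: "\<And>u v g. u \<in> carrier G \<Longrightarrow> v \<in> carrier G \<Longrightarrow> g \<in> carrier G \<Longrightarrow>
                \<phi> u = \<phi> v \<Longrightarrow> \<phi> (u \<otimes> g) = \<phi> (v \<otimes> g)"
    and h: "h \<in> carrier G"
  shows "\<exists>w. set w \<subseteq> Y \<and> length w < card F \<and> \<phi> (word_prod G w) = \<phi> h"
proof -
  let ?P = "\<lambda>w. set w \<subseteq> Y \<and> \<phi> (word_prod G w) = \<phi> h"
  have "\<exists>w. ?P w" using generate_eq_word_prod[OF Y] gen h by force
  then obtain w where w: "?P w" and min: "\<And>v. ?P v \<Longrightarrow> length w \<le> length v"
    using ex_has_least_nat[of ?P _ length] by blast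
  have wc: "set w \<subseteq> carrier G" using w Y by auto
  have sub: "set (take i w) \<subseteq> carrier G" "set (drop i w) \<subseteq> carrier G" for i
    using wc by (auto dest: in_set_takeD in_set_dropD)
  have "i = j" if ij: "i \<le> length w" "j \<le> length w" "i < j"
    and eq: "\<phi> (word_prod G (take i w)) = \<phi> (word_prod G (take j w))" for i j
  proof -
    have "\<phi> (word_prod G (take i w @ drop j w)) = \<phi> (word_prod G (take j w @ drop j w))"
      using sub eq by (simp del: append_take_drop_id add: comp)
    then have "?P (take i w @ drop j w)"
      using w by (auto dest: in_set_takeD in_set_dropD)
    from min[OF this] ij show ?thesis by simp
  qed
  \<comment> \<open>Counting the empty prefix, there are \<open>length w + 1\<close> prefixes,
    whence the strict inequality \<open>length w < card F\<close>.\<close>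
  then have "inj_on (\<lambda>i. \<phi> (word_prod G (take i w))) {..length w}"
    by (intro linorder_inj_onI) auto
  moreover have "(\<lambda>i. \<phi> (word_prod G (take i w))) ` {..length w} \<subseteq> F"
    using fin sub by auto
  ultimately have "card {..length w} \<le> card F"
    using fin(1) card_inj_on_le by blast
  then show ?thesis using w by auto
qed

section \<open>Schur's theorem\<close>

definition commutators_in :: "'a set \<Rightarrow> 'a set" where
  "commutators_in U = {commutator G u v | u v. u \<in> U \<and> v \<in> U}"

text \<open>Since p g = g p^g, a letter \<open>g\<close> moves to the front when every letter it
  passes is conjugated by \<open>g\<close>. Closure of \<open>\<Gamma>\<close> under conjugation
  keeps the new letters in \<open>\<Gamma>\<close>, and passed occurrences of \<open>g\<close>
  survive because g^g = g.\<close>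

lemma pull_out_letter:
  assumes \<Gamma>: "\<Gamma> \<subseteq> carrier G" "\<And>x y. x \<in> \<Gamma> \<Longrightarrow> y \<in> \<Gamma> \<Longrightarrow> conj_by G x y \<in> \<Gamma>"
    and "set w \<subseteq> \<Gamma>" "j \<le> count_list w g"
  shows "\<exists>r. set r \<subseteq> \<Gamma> \<and> length r + j = length w \<and> word_prod G w = g [^] j \<otimes> word_prod G r"
  using assms(3,4)
proof (induction j arbitrary: w)
  case 0
  then show ?case using \<Gamma> by (intro exI[of _ w]) auto
next
  case (Suc j)
  then have "g \<in> set w" using count_notin by fastforce
  then obtain p q where w: "w = p @ g # q" by (meson split_list)
  define v where "v = map (conj_by G g) p @ q"
  have g: "g \<in> carrier G" "g \<in> \<Gamma>" using Suc.prems w \<Gamma> by auto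
  have pq: "set p \<subseteq> carrier G" "set q \<subseteq> carrier G" using Suc.prems w \<Gamma> by auto
  have "conj_by G g g = g" using g by (simp add: free_group_simps)
  then have "count_list p g \<le> count_list (map (conj_by G g) p) g"
    using count_list_map_ge[of p g "conj_by G g"] by simp
  then have cnt: "j \<le> count_list v g" using Suc.prems w by (simp add: v_def)
  have v\<Gamma>: "set v \<subseteq> \<Gamma>" using Suc.prems w \<Gamma> g by (auto simp: v_def)
  from Suc.IH[OF v\<Gamma> cnt] obtain r where r: "set r \<subseteq> \<Gamma>" "length r + j = length v"
    "word_prod G v = g [^] j \<otimes> word_prod G r" by blast
  have mc: "set (map (conj_by G g) p) \<subseteq> carrier G" using pq g by auto
  have "word_prod G w = word_prod G p \<otimes> (g \<otimes> word_prod G q)"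
    using pq g by (simp add: w)
  also have "\<dots> = g \<otimes> (conj_by G g (word_prod G p) \<otimes> word_prod G q)"
    using pq g by (simp add: free_group_simps)
  also have "\<dots> = g \<otimes> word_prod G v"
    using pq g mc by (simp only: v_def word_prod_append word_prod_map_conj_by)
  also have "\<dots> = g [^] Suc j \<otimes> word_prod G r"
    using g r \<Gamma> nat_pow_Suc2[OF g(1), of j] by (simp add: r(3) m_assoc[symmetric] del: nat_pow_Suc)
  finally show ?case using r w by (intro exI[of _ r]) (auto simp: v_def)
qed

text \<open>
  Rosenlicht's identity: with \<open>g = [a, b]\<close> and \<open>g\<^sup>j\<close> central,
  \<open>g\<^sup>j\<^sup>+\<^sup>1 = a\<inverse> b\<inverse> a g\<^sup>j b = [a, b\<^sup>2] (b\<inverse> g b)\<^sup>j\<^sup>-\<^sup>1\<close> is a product of \<open>j\<close> commutators.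
\<close>

lemma commutator_power_shorter:
  assumes U: "subgroup U G" "a \<in> U" "b \<in> U" and j: "j \<ge> 1"
    and central: "commutator G a b [^] j \<otimes> b = b \<otimes> commutator G a b [^] j"
  shows "\<exists>w. set w \<subseteq> commutators_in U \<and> length w = j \<and> word_prod G w = commutator G a b [^] Suc j"
proof -
  define g where "g = commutator G a b"
  interpret U: subgroup U G by fact
  have c: "a \<in> carrier G" "b \<in> carrier G" "g \<in> carrier G" "g \<in> U"
    using U U.subset unfolding g_def by (auto simp: commutator_def)
  from j obtain i where i: "j = Suc i" by (cases j) auto
  define w where "w = commutator G a (b \<otimes> b) # replicate i (conj_by G b g)"
  have cg: "conj_by G b g = commutator G (conj_by G b a) (conj_by G b b)"
    using c by (simp add: g_def conj_by_commutator)
  have "conj_by G b a \<in> U" "conj_by G b b \<in> U" using U by (simp_all add: conj_by_def)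
  then have "conj_by G b g \<in> commutators_in U" unfolding cg commutators_in_def by blast
  moreover have "commutator G a (b \<otimes> b) \<in> commutators_in U"
    using U by (auto simp: commutators_in_def)
  ultimately have "set w \<subseteq> commutators_in U"
    by (auto simp: w_def)
  moreover have "word_prod G w = g [^] Suc j"
  proof -
    have "set (replicate i g) \<subseteq> carrier G" using c by auto
    then have "word_prod G (replicate i (conj_by G b g)) = conj_by G b (g [^] i)"
      using word_prod_map_conj_by[of b "replicate i g"] c
      by (simp add: word_prod_replicate map_replicate)
    then have "word_prod G w = commutator G a (b \<otimes> b) \<otimes> (inv b \<otimes> g [^] i \<otimes> b)"
      by (simp add: w_def conj_by_def)
    also have "\<dots> = inv a \<otimes> inv b \<otimes> a \<otimes> (g \<otimes> g [^] i \<otimes> b)"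
      using c by (simp add: free_group_simps g_def)
    also have "g \<otimes> g [^] i = g [^] j" using c(3) i nat_pow_Suc2 by metis
    also have "g [^] j \<otimes> b = b \<otimes> g [^] j" using central by (simp add: g_def)
    also have "inv a \<otimes> inv b \<otimes> a \<otimes> (b \<otimes> g [^] j) = g \<otimes> g [^] j"
      using c by (simp add: free_group_simps g_def)
    also have "\<dots> = g [^] Suc j" using c(3) nat_pow_Suc2 by metis
    finally show ?thesis .
  qed
  ultimately show ?thesis by (intro exI[of _ w]) (auto simp: w_def i g_def)
qed

end

text \<open>The number of words of length at most \<open>k * (k * k)\<close> over an alphabet of
  \<open>k * k\<close> letters.\<close>

definition schur_bound :: "nat \<Rightarrow> nat" where
  "schur_bound k = (\<Sum>i\<le>k * (k * k). (k * k) ^ i)"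

text \<open>The map \<open>\<phi>\<close> stands for the cosets of the centre of \<open>U\<close>:
  elements with equal values differ by a central factor, so there are at most \<open>k\<close>
  cosets. Hence \<open>U\<close> has at most \<open>k * k\<close> commutators, and in a shortest
  product of commutators none occurs more than \<open>k\<close> times.\<close>

lemma (in group) schur_finite_derived:
  assumes U: "subgroup U G"
    and F: "finite F" "card F \<le> k" "\<phi> ` U \<subseteq> F"
    and central: "\<And>u v x. u \<in> U \<Longrightarrow> v \<in> U \<Longrightarrow> x \<in> U \<Longrightarrow> \<phi> u = \<phi> v \<Longrightarrow>
                    (u \<otimes> inv v) \<otimes> x = x \<otimes> (u \<otimes> inv v)"
  shows "finite (derived G U) \<and> card (derived G U) \<le> schur_bound k"
proof -
  interpret U: subgroup U G by fact
  define \<Gamma> where "\<Gamma> = commutators_in U"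
  have Uc: "U \<subseteq> carrier G" by (rule U.subset)
  have c\<Gamma>: "\<Gamma> \<subseteq> carrier G" using Uc by (auto simp: \<Gamma>_def commutators_in_def)
  have \<Gamma>U: "\<Gamma> \<subseteq> U" by (auto simp: \<Gamma>_def commutators_in_def commutator_def)
  have conj\<Gamma>: "conj_by G x y \<in> \<Gamma>" if "x \<in> U" "y \<in> \<Gamma>" for x y
  proof -
    from that obtain u v where uv: "u \<in> U" "v \<in> U" "y = commutator G u v"
      by (auto simp: \<Gamma>_def commutators_in_def)
    have "conj_by G x y = commutator G (conj_by G x u) (conj_by G x v)"
      using that uv Uc by (auto intro!: conj_by_commutator)
    moreover have "conj_by G x u \<in> U" "conj_by G x v \<in> U"
      using that uv by (simp_all add: conj_by_def)
    ultimately show ?thesis by (auto simp: \<Gamma>_def commutators_in_def)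
  qed
  have inv\<Gamma>: "inv y \<in> \<Gamma>" if "y \<in> \<Gamma>" for y
    using that Uc inv_commutator by (fastforce simp: \<Gamma>_def commutators_in_def)

  \<comment> \<open>A commutator does not change when an argument is multiplied by a central
    element, so it depends only on the \<open>\<phi>\<close>-values of its arguments.\<close>
  have eq: "commutator G u x = commutator G u' x' "
    if "u \<in> U" "u' \<in> U" "x \<in> U" "x' \<in> U" "\<phi> u = \<phi> u'" "\<phi> x = \<phi> x'" for u u' x x'
  proof -
    have *: "commutator G (z \<otimes> u) x = commutator G u x" "commutator G x (z \<otimes> u) = commutator G x u"
      if "z \<in> carrier G" "u \<in> carrier G" "x \<in> carrier G" "z \<otimes> x = x \<otimes> z" for z u x
    proof -
      have "inv x \<otimes> z \<otimes> x = z" using that by (simp add: m_assoc inv_mult_cancel)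
      then have e: "inv z \<otimes> inv x \<otimes> z \<otimes> x = \<one>" using that by (simp add: m_assoc)
      have "inv z \<otimes> (inv x \<otimes> z) = inv x" using that e
        by (metis inv_closed inv_equality m_assoc m_closed)
      then have i: "inv z \<otimes> inv x \<otimes> z = inv x" using that by (simp add: m_assoc)
      have "commutator G (z \<otimes> u) x = inv u \<otimes> (inv z \<otimes> inv x \<otimes> z) \<otimes> u \<otimes> x"
        using that by (simp add: free_group_simps)
      then show "commutator G (z \<otimes> u) x = commutator G u x"
        using i by (simp add: commutator_def)
      then show "commutator G x (z \<otimes> u) = commutator G x u"
        using that by (metis inv_commutator m_closed)
    qed
    let ?z = "u \<otimes> inv u'" and ?t = "x \<otimes> inv x'"
    have c: "u \<in> carrier G" "u' \<in> carrier G" "x \<in> carrier G" "x' \<in> carrier G" using that Uc by auto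
    have "?z \<otimes> x = x \<otimes> ?z" "?t \<otimes> u' = u' \<otimes> ?t"
      using that central by blast+
    then have "commutator G (?z \<otimes> u') x = commutator G u' x"
      "commutator G u' (?t \<otimes> x') = commutator G u' x'"
      using *[of ?z u' x] *[of ?t x' u'] c by auto
    then show ?thesis using c by (simp add: m_assoc)
  qed
  have card\<Gamma>: "finite \<Gamma> \<and> card \<Gamma> \<le> k * k"
  proof -
    define \<psi> where "\<psi> f = (SOME u. u \<in> U \<and> \<phi> u = f)" for f
    have \<psi>: "\<psi> (\<phi> u) \<in> U" "\<phi> (\<psi> (\<phi> u)) = \<phi> u" if "u \<in> U" for u
      unfolding \<psi>_def using someI[of "\<lambda>v. v \<in> U \<and> \<phi> v = \<phi> u" u] that by auto
    have "\<Gamma> \<subseteq> (\<lambda>(p, q). commutator G (\<psi> p) (\<psi> q)) ` (F \<times> F)"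
    proof
      fix y assume "y \<in> \<Gamma>"
      then obtain u v where uv: "u \<in> U" "v \<in> U" "y = commutator G u v"
        by (auto simp: \<Gamma>_def commutators_in_def)
      have "y = commutator G (\<psi> (\<phi> u)) (\<psi> (\<phi> v))"
        unfolding uv(3) by (rule eq) (use \<psi> uv in auto)
      moreover have "\<phi> u \<in> F" "\<phi> v \<in> F" using uv F by auto
      ultimately show "y \<in> (\<lambda>(p, q). commutator G (\<psi> p) (\<psi> q)) ` (F \<times> F)" by force
    qed
    then have "finite \<Gamma>" "card \<Gamma> \<le> card F * card F"
      using F(1) surj_card_le[of "F \<times> F" \<Gamma>] by (auto simp: card_cartesian_product intro: finite_subset)
    then show ?thesis using F(2) by (meson le_trans mult_le_mono)
  qed

  have power: "\<exists>j. 1 \<le> j \<and> j \<le> k \<and> (\<forall>x \<in> U. g [^] j \<otimes> x = x \<otimes> g [^] j)" if g: "g \<in> U" for g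
  proof -
    have gU: "g [^] i \<in> U" for i :: nat using g by (induction i) auto
    \<comment> \<open>The \<open>k + 1\<close> powers of \<open>g\<close> with exponents 0 to
      \<open>k\<close> share at most \<open>k\<close> values, so some \<open>g [^] j\<close> with
      \<open>1 \<le> j\<close> and \<open>j \<le> k\<close> is central in \<open>U\<close>.\<close>
    have "\<not> inj_on (\<lambda>i. \<phi> (g [^] i)) {..k}"
    proof
      assume "inj_on (\<lambda>i. \<phi> (g [^] i)) {..k}"
      then have "card {..k} \<le> card F" using F gU by (intro card_inj_on_le) auto
      then show False using F(2) by simp
    qed
    then obtain p q where "p \<in> {..k}" "q \<in> {..k}" "\<phi> (g [^] p) = \<phi> (g [^] q)" "p \<noteq> q"
      unfolding inj_on_def by blast
    then obtain p q :: nat where pq: "p < q" "q \<le> k" "\<phi> (g [^] q) = \<phi> (g [^] p)"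
      by (metis atMost_iff linorder_neqE_nat)
    have gc: "g \<in> carrier G" using g Uc by auto
    have "g [^] q = g [^] (q - p) \<otimes> g [^] p" using pq gc by (simp add: nat_pow_mult)
    then have "g [^] q \<otimes> inv (g [^] p) = g [^] (q - p)"
      using gc by (simp add: m_assoc)
    then show ?thesis using pq central[OF gU gU _ pq(3)]
      by (intro exI[of _ "q - p"]) auto
  qed
  have gen: "derived G U = generate G \<Gamma>"
    unfolding derived_eq_commutator_subgroup[OF U] commutator_subgroup_def \<Gamma>_def commutators_in_def ..
  have "derived G U \<subseteq> word_prod G ` {w. set w \<subseteq> \<Gamma> \<and> length w \<le> k * (k * k)}"
  proof
    fix x assume "x \<in> derived G U"
    let ?P = "\<lambda>w. set w \<subseteq> \<Gamma> \<and> word_prod G w = x"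
    have "\<exists>w. ?P w"
      using \<open>x \<in> derived G U\<close> generate_eq_word_prod[OF c\<Gamma>] inv\<Gamma> unfolding gen by force
    then obtain w where w: "?P w" and min: "\<And>v. ?P v \<Longrightarrow> length w \<le> length v"
      using ex_has_least_nat[of ?P _ length] by blast
    \<comment> \<open>In a longer word some commutator \<open>g\<close> occurs at least
      \<open>k + 1\<close> times, hence at least \<open>j + 1\<close> times, where
      \<open>g [^] j\<close> is central in \<open>U\<close>. Pulling \<open>j + 1\<close> copies to
      the front and rewriting them as \<open>j\<close> commutators would shorten a word of least
      length.\<close>
    have "length w \<le> k * card \<Gamma>"
    proof (rule ccontr)
      assume "\<not> length w \<le> k * card \<Gamma>"
      then have "sum (count_list w) \<Gamma> > k * card \<Gamma>"
        using sum_count_set[of w \<Gamma>] w card\<Gamma> by simp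
      then obtain g where g: "g \<in> \<Gamma>" "count_list w g > k"
        using sum_bounded_above[of \<Gamma> "count_list w" k] by (force simp: mult.commute not_less)
      from power[of g] g(1) \<Gamma>U obtain j where
        j: "1 \<le> j" "j \<le> k" "\<And>x. x \<in> U \<Longrightarrow> g [^] j \<otimes> x = x \<otimes> g [^] j" by blast
      from g(1) obtain a b where ab: "a \<in> U" "b \<in> U" "g = commutator G a b"
        by (auto simp: \<Gamma>_def commutators_in_def)
      obtain v where v: "set v \<subseteq> \<Gamma>" "length v = j" "word_prod G v = g [^] Suc j"
        using commutator_power_shorter[OF U ab(1,2) j(1)] j(3)[OF ab(2)] ab(3)
        unfolding \<Gamma>_def by blast
      obtain r where r: "set r \<subseteq> \<Gamma>" "length r + Suc j = length w"
        "word_prod G w = g [^] Suc j \<otimes> word_prod G r"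
        using pull_out_letter[OF c\<Gamma>, of w "Suc j" g] conj\<Gamma> \<Gamma>U w g(2) j(2) by auto
      have "?P (v @ r)"
        using v r w c\<Gamma> by (auto simp del: nat_pow_Suc)
      from min[OF this] show False using v r by simp
    qed
    also have "\<dots> \<le> k * (k * k)" using card\<Gamma> by simp
    finally show "x \<in> word_prod G ` {w. set w \<subseteq> \<Gamma> \<and> length w \<le> k * (k * k)}" using w by blast
  qed
  moreover have "finite {w. set w \<subseteq> \<Gamma> \<and> length w \<le> k * (k * k)}"
    using card\<Gamma> by (intro finite_lists_length_le) auto
  ultimately have "finite (derived G U)" "card (derived G U) \<le> card {w. set w \<subseteq> \<Gamma> \<and> length w \<le> k * (k * k)}"
    by (auto intro: finite_subset surj_card_le)
  moreover have "card {w. set w \<subseteq> \<Gamma> \<and> length w \<le> k * (k * k)} \<le> schur_bound k"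
    using card\<Gamma> by (auto simp: card_lists_length_le schur_bound_def intro!: sum_mono power_mono)
  ultimately show ?thesis by simp
qed

section \<open>Centrality modulo a normal subgroup\<close>

context group
begin

text \<open>For normal \<open>N\<close> this is the preimage of the centre of the quotient by
  \<open>N\<close>; the quotient itself is never formed.\<close>

definition central_mod :: "'a set \<Rightarrow> 'a set" where
  "central_mod N = {x \<in> carrier G. \<forall>h \<in> carrier G. commutator G x h \<in> N}"

lemma central_mod_closed: "central_mod N \<subseteq> carrier G"
  by (auto simp: central_mod_def)

lemma central_mod_mono: "M \<subseteq> N \<Longrightarrow> central_mod M \<subseteq> central_mod N"
  by (auto simp: central_mod_def)

lemma central_mod_normal:
  assumes N: "N \<lhd> G"
  shows "central_mod N \<lhd> G"
proof (rule normal_conj_byI)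
  interpret N: normal N G by fact
  show "subgroup (central_mod N) G"
  proof
    show "central_mod N \<subseteq> carrier G" by (rule central_mod_closed)
    show "\<one> \<in> central_mod N" by (auto simp: central_mod_def commutator_def)
  next
    fix x y assume xy: "x \<in> central_mod N" "y \<in> central_mod N"
    have "commutator G (x \<otimes> y) h \<in> N" if h: "h \<in> carrier G" for h
    proof -
      have "commutator G (x \<otimes> y) h = conj_by G y (commutator G x h) \<otimes> commutator G y h"
        using xy h by (simp add: central_mod_def free_group_simps)
      moreover have "conj_by G y (commutator G x h) \<in> N"
        using xy h by (auto simp: central_mod_def intro!: conj_by_normal[OF N])
      moreover have "commutator G y h \<in> N" using xy h by (auto simp: central_mod_def)
      ultimately show ?thesis by simp
    qed
    then show "x \<otimes> y \<in> central_mod N" using xy by (simp add: central_mod_def)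
  next
    fix x assume x: "x \<in> central_mod N"
    have "commutator G (inv x) h \<in> N" if h: "h \<in> carrier G" for h
    proof -
      have "commutator G (inv x) h = conj_by G (inv x) (inv (commutator G x h))"
        using x h by (simp add: central_mod_def free_group_simps)
      moreover have "inv (commutator G x h) \<in> N" using x h by (simp add: central_mod_def)
      ultimately show ?thesis using x conj_by_normal[OF N] by (simp add: central_mod_def)
    qed
    then show "inv x \<in> central_mod N" using x by (simp add: central_mod_def)
  qed
next
  fix g x assume g: "g \<in> carrier G" and x: "x \<in> central_mod N"
  have "commutator G (conj_by G g x) h \<in> N" if h: "h \<in> carrier G" for h
  proof -
    have "commutator G (conj_by G g x) h = conj_by G g (commutator G x (conj_by G (inv g) h))"
      using x g h by (simp add: central_mod_def free_group_simps)
    then show ?thesis using x g h conj_by_normal[OF N] by (simp add: central_mod_def)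
  qed
  then show "conj_by G g x \<in> central_mod N" using g x by (simp add: central_mod_def)
qed

lemma conj_by_normal_iff:
  assumes "N \<lhd> G" "g \<in> carrier G" "x \<in> carrier G"
  shows "conj_by G g x \<in> N \<longleftrightarrow> x \<in> N"
proof
  assume "conj_by G g x \<in> N"
  then have "conj_by G (inv g) (conj_by G g x) \<in> N" using assms conj_by_normal by simp
  then show "x \<in> N" using assms by (simp add: free_group_simps)
qed (use assms conj_by_normal in auto)

lemma commutator_in_normal:
  assumes N: "N \<lhd> G" and "u \<in> carrier G" "v \<in> carrier G" "u \<in> N \<or> v \<in> N"
  shows "commutator G u v \<in> N"
proof -
  interpret N: normal N G by fact
  have "commutator G u v = inv u \<otimes> conj_by G v u" "commutator G u v = conj_by G u (inv v) \<otimes> v"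
    using assms by (simp_all add: free_group_simps)
  with assms conj_by_normal[OF N] show ?thesis by (metis N.m_closed N.m_inv_closed)
qed

text \<open>Multiplying \<open>d\<close> by \<open>u\<^sub>1\<close> or \<open>e\<close> by
  \<open>u\<^sub>2\<close> on the left changes the commutator [d, e] by a left factor from
  \<open>U\<close>. The factors \<open>p'\<close> and \<open>q'\<close> of the single changes lie in
  \<open>N\<close> by hypothesis, and so does the factor \<open>p' \<otimes> r' \<otimes> q'\<close>
  of both changes together; cancelling leaves \<open>r'\<close>, a conjugate of the commutator of
  \<open>u\<^sub>1\<close> and \<open>u\<^sub>2\<close>.\<close>

lemma commutators_central_mod_if_translates:
  assumes U: "U \<lhd> G" and N: "N \<lhd> G"
    and de: "d \<in> carrier G" "e \<in> carrier G"
    and translate: "\<And>u. u \<in> U \<Longrightarrow> u \<otimes> commutator G d e \<in> commutators G \<Longrightarrow> u \<in> N"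
    and u: "u\<^sub>1 \<in> U" "u\<^sub>2 \<in> U"
  shows "commutator G u\<^sub>1 u\<^sub>2 \<in> N"
proof -
  interpret N: normal N G by fact
  interpret U: normal U G by fact
  define a where "a = commutator G d e"
  define p where "p = commutator G u\<^sub>1 e"
  define q where "q = commutator G d u\<^sub>2"
  define r where "r = commutator G u\<^sub>1 u\<^sub>2"
  have c: "u\<^sub>1 \<in> carrier G" "u\<^sub>2 \<in> carrier G" "a \<in> carrier G" "p \<in> carrier G" "q \<in> carrier G"
    "r \<in> carrier G" using u de by (auto simp: a_def p_def q_def r_def)
  have Us: "p \<in> U" "q \<in> U" "r \<in> U"
    using u c de commutator_in_normal[OF U] by (auto simp: p_def q_def r_def)
  have tr: "u \<in> N" if "u \<in> U" "u \<otimes> a = commutator G x y" "x \<in> carrier G" "y \<in> carrier G" for u x y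
    using translate[of u] that unfolding commutators_def a_def by blast
  \<comment> \<open>These conjugations bring the expanded commutators into the form of an element of
    \<open>U\<close> times \<open>a\<close>; the one by \<open>inv a\<close> moves a factor from the
    right of \<open>a\<close> to its left.\<close>
  define p' where "p' = conj_by G d p"
  define q' where "q' = conj_by G (inv a) (conj_by G e q)"
  define r' where "r' = conj_by G d (conj_by G e r)"
  have Us': "p' \<in> U" "q' \<in> U" "r' \<in> U"
    using Us c de conj_by_normal[OF U] by (auto simp: p'_def q'_def r'_def)
  have "p' \<in> N"
  proof (rule tr)
    show "p' \<otimes> a = commutator G (u\<^sub>1 \<otimes> d) e"
      using c(1,2) de by (simp add: p'_def p_def a_def free_group_simps)
  qed (use Us' c de in auto)
  moreover have "q' \<in> N"
  proof (rule tr)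
    show "q' \<otimes> a = commutator G d (u\<^sub>2 \<otimes> e)"
      using c(1,2) de by (simp add: q'_def q_def a_def free_group_simps)
  qed (use Us' c de in auto)
  moreover have "p' \<otimes> r' \<otimes> q' \<in> N"
  proof (rule tr)
    show "p' \<otimes> r' \<otimes> q' \<otimes> a = commutator G (u\<^sub>1 \<otimes> d) (u\<^sub>2 \<otimes> e)"
      using c(1,2) de by (simp add: p'_def p_def q'_def r'_def q_def a_def r_def free_group_simps)
  qed (use Us' c de in auto)
  ultimately have "inv p' \<otimes> (p' \<otimes> r' \<otimes> q') \<otimes> inv q' \<in> N" by blast
  moreover have "inv p' \<otimes> (p' \<otimes> r' \<otimes> q') \<otimes> inv q' = r'"
    using Us' by (simp add: m_assoc inv_mult_cancel)
  ultimately have "r' \<in> N" by simp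
  then show ?thesis using c de conj_by_normal_iff[OF N] unfolding r'_def r_def[symmetric] by simp
qed

lemma centralizer_subgroup:
  assumes "z \<in> carrier G"
  shows "subgroup {x \<in> carrier G. z \<otimes> x = x \<otimes> z} G" (is "subgroup ?C G")
proof
  show "\<one> \<in> ?C" using assms by simp
next
  fix x y assume "x \<in> ?C" "y \<in> ?C"
  then show "x \<otimes> y \<in> ?C" using assms by (simp flip: m_assoc) (simp add: m_assoc)
next
  fix x assume x: "x \<in> ?C"
  then have "inv x \<otimes> z \<otimes> x = z" using assms by (simp add: m_assoc inv_mult_cancel)
  then have "inv x \<otimes> z = z \<otimes> inv x" using assms x by (simp add: inv_solve_right)
  then show "inv x \<in> ?C" using x by simp
qed auto

lemma commute_generate:
  assumes "T \<subseteq> carrier G" "z \<in> carrier G" "\<And>t. t \<in> T \<Longrightarrow> z \<otimes> t = t \<otimes> z" "x \<in> generate G T"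
  shows "z \<otimes> x = x \<otimes> z"
  using generate_subgroup_incl[OF _ centralizer_subgroup[OF assms(2)], of T] assms by blast

section \<open>The conjugation action on a normal subset and its kernel\<close>

definition conj_closed :: "'a set \<Rightarrow> bool" where
  "conj_closed T \<longleftrightarrow> T \<subseteq> carrier G \<and> (\<forall>g \<in> carrier G. \<forall>t \<in> T. conj_by G g t \<in> T)"

text \<open>Restriction to \<open>T\<close> makes the action an element of the finite set
  \<open>T \<rightarrow>\<^sub>E T\<close>, so that acting alike on \<open>T\<close> becomes an
  equality of functions.\<close>

definition conj_action :: "'a set \<Rightarrow> 'a \<Rightarrow> 'a \<Rightarrow> 'a" where
  "conj_action T g = (\<lambda>t \<in> T. conj_by G g t)"

definition centralizer :: "'a set \<Rightarrow> 'a set" where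
  "centralizer T = {u \<in> carrier G. \<forall>t \<in> T. u \<otimes> t = t \<otimes> u}"

lemma conj_action_in: "conj_closed T \<Longrightarrow> conj_action T ` carrier G \<subseteq> T \<rightarrow>\<^sub>E T"
  by (auto simp: conj_closed_def conj_action_def)

lemma conj_action_codomain:
  assumes "finite T" "card T \<le> t"
  shows "finite (T \<rightarrow>\<^sub>E T)" "card (T \<rightarrow>\<^sub>E T) \<le> t ^ t"
proof -
  show "finite (T \<rightarrow>\<^sub>E T)" using assms by (auto intro: finite_PiE)
  have "card T ^ card T \<le> t ^ t"
  \<comment> \<open>Raising the exponent needs a base of at least 1; for \<open>t = 0\<close> both
    sides are \<open>0 ^ 0 = 1\<close>.\<close>
  proof (cases "t = 0")
    case False
    then have "card T ^ card T \<le> t ^ card T" "t ^ card T \<le> t ^ t"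
      using assms by (auto intro: power_mono power_increasing)
    then show ?thesis by simp
  qed (use assms in auto)
  then show "card (T \<rightarrow>\<^sub>E T) \<le> t ^ t" using assms by (simp add: card_funcsetE)
qed

lemma conj_action_eqD:
  "conj_action T u = conj_action T v \<Longrightarrow> t \<in> T \<Longrightarrow> conj_by G u t = conj_by G v t"
  unfolding conj_action_def by (metis restrict_apply')

text \<open>Supplies the compatibility with right multiplication that
  \<open>short_words_cover\<close> asks of a map, here the action on \<open>T\<close>.\<close>

lemma conj_action_mult_cong:
  assumes "T \<subseteq> carrier G" "u \<in> carrier G" "v \<in> carrier G" "g \<in> carrier G"
    and "conj_action T u = conj_action T v"
  shows "conj_action T (u \<otimes> g) = conj_action T (v \<otimes> g)"
  unfolding conj_action_def
proof (rule restrict_ext)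
  fix t assume t: "t \<in> T"
  then have "t \<in> carrier G" using assms by auto
  then show "conj_by G (u \<otimes> g) t = conj_by G (v \<otimes> g) t"
    using conj_action_eqD[OF assms(5) t] assms(2-4) by (simp flip: conj_by_conj_by)
qed

text \<open>Elements acting alike lie in one coset of the kernel, so counting actions bounds the
  index of \<open>centralizer T\<close>.\<close>

lemma conj_action_eq_centralizer:
  assumes "T \<subseteq> carrier G" "u \<in> carrier G" "v \<in> carrier G" "conj_action T u = conj_action T v"
  shows "u \<otimes> inv v \<in> centralizer T"
proof -
  have "(u \<otimes> inv v) \<otimes> t = t \<otimes> (u \<otimes> inv v)" if t: "t \<in> T" for t
  proof -
    have tc: "t \<in> carrier G" using t assms by auto
    have "conj_by G (u \<otimes> inv v) t = conj_by G (inv v) (conj_by G u t)"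
      using assms tc by (simp add: conj_by_conj_by)
    also have "\<dots> = conj_by G (inv v) (conj_by G v t)"
      using conj_action_eqD[OF assms(4) t] by simp
    also have "\<dots> = t" using assms tc by (simp add: free_group_simps)
    finally show ?thesis using assms tc conj_by_eq_self_iff by simp
  qed
  then show ?thesis using assms by (simp add: centralizer_def)
qed

lemma centralizer_normal:
  assumes T: "conj_closed T"
  shows "centralizer T \<lhd> G"
proof -
  define C where "C t = {x \<in> carrier G. t \<otimes> x = x \<otimes> t}" for t
  have Tc: "T \<subseteq> carrier G" using T by (simp add: conj_closed_def)
  have C: "subgroup (C t) G" if "t \<in> T" for t
    unfolding C_def using that Tc by (intro centralizer_subgroup) auto
  have mem: "x \<in> centralizer T \<longleftrightarrow> x \<in> carrier G \<and> (\<forall>t \<in> T. x \<in> C t)" for x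
    by (auto simp: centralizer_def C_def)
  have "subgroup (centralizer T) G"
    by (rule subgroup.intro)
      (auto simp: mem intro: subgroup.m_closed[OF C] subgroup.one_closed[OF C] subgroup.m_inv_closed[OF C])
  moreover have "conj_by G g x \<in> centralizer T"
    if g: "g \<in> carrier G" and x: "x \<in> centralizer T" for g x
  proof -
  have "conj_by G g x \<otimes> t = t \<otimes> conj_by G g x" if t: "t \<in> T" for t
  proof -
    \<comment> \<open>As \<open>T\<close> is closed under conjugation, \<open>t\<close> comes from
      an element \<open>s\<close> of \<open>T\<close>; conjugating the relation between
      \<open>x\<close> and \<open>s\<close> by \<open>g\<close> gives the one for
      \<open>t\<close>.\<close>
    define s where "s = conj_by G (inv g) t"
    have s: "s \<in> T" "s \<in> carrier G" using T t g Tc by (auto simp: conj_closed_def s_def)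
    have ts: "t = conj_by G g s" using t g Tc by (auto simp: s_def free_group_simps)
    have "x \<in> carrier G" "x \<otimes> s = s \<otimes> x" using x s by (auto simp: centralizer_def)
    then show ?thesis unfolding ts using g s(2) by (simp flip: conj_by_mult)
  qed
  then show ?thesis using g x by (simp add: centralizer_def)
  qed
  ultimately show ?thesis by (rule normal_conj_byI)
qed

text \<open>The product of the subgroups chosen for the single elements of \<open>S\<close> is
  normal, has order at most the product of their orders, and contains each of them, so centrality
  modulo a factor persists.\<close>

lemma finite_normal_product:
  assumes "finite S" and B: "\<And>s. s \<in> S \<Longrightarrow> \<exists>N. N \<lhd> G \<and> finite N \<and> card N \<le> B \<and> s \<in> central_mod N"
  shows "\<exists>M. M \<lhd> G \<and> finite M \<and> card M \<le> B ^ card S \<and> S \<subseteq> central_mod M"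
  using assms
proof (induction S rule: finite_induct)
  case empty
  then show ?case using one_is_normal by (intro exI[of _ "{\<one>}"]) auto
next
  case (insert s S)
  then obtain M N where M: "M \<lhd> G" "finite M" "card M \<le> B ^ card S" "S \<subseteq> central_mod M"
    and N: "N \<lhd> G" "finite N" "card N \<le> B" "s \<in> central_mod N" by (meson insertCI)
  interpret M: normal M G by fact
  interpret N: normal N G by fact
  have eq: "N <#> M = (\<lambda>(x, y). x \<otimes> y) ` (N \<times> M)" by (auto simp: set_mult_def)
  have "card (N <#> M) \<le> card N * card M"
    unfolding eq using M N card_image_le[of "N \<times> M"] by (simp add: card_cartesian_product)
  also have "\<dots> \<le> B * B ^ card S" using M N by (intro mult_mono) auto
  finally have "card (N <#> M) \<le> B ^ card (insert s S)" using insert by simp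
  moreover have "finite (N <#> M)" unfolding eq using M N by auto
  moreover have "N <#> M \<lhd> G"
  proof (rule normal_conj_byI)
    show "subgroup (N <#> M) G" using mult_norm_subgroup[OF N(1)] M.subgroup_axioms by blast
    fix g x assume "g \<in> carrier G" "x \<in> N <#> M"
    moreover from this obtain y z where "y \<in> N" "z \<in> M" "x = y \<otimes> z" by (auto simp: set_mult_def)
    ultimately have "conj_by G g x = conj_by G g y \<otimes> conj_by G g z" "conj_by G g y \<in> N" "conj_by G g z \<in> M"
      by (auto simp: conj_by_mult intro: conj_by_normal[OF M(1)] conj_by_normal[OF N(1)])
    then show "conj_by G g x \<in> N <#> M" unfolding set_mult_def by blast
  qed
  moreover have "M \<subseteq> N <#> M"
  proof
    fix x assume "x \<in> M"
    then have "x = \<one> \<otimes> x" by simp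
    with \<open>x \<in> M\<close> show "x \<in> N <#> M" unfolding set_mult_def using N.one_closed by blast
  qed
  moreover have "N \<subseteq> N <#> M"
  proof
    fix x assume "x \<in> N"
    then have "x = x \<otimes> \<one>" by simp
    with \<open>x \<in> N\<close> show "x \<in> N <#> M" unfolding set_mult_def using M.one_closed by blast
  qed
  ultimately show ?case using M N central_mod_mono[of M "N <#> M"] central_mod_mono[of N "N <#> M"]
    by (intro exI[of _ "N <#> M"]) auto
qed

end

section \<open>Groups generated by elements with small classes\<close>

text \<open>In the application \<open>G\<close> is the derived group of a larger group and
  \<open>Y\<close> is the set of commutators of the larger group, of which the commutators of
  \<open>G\<close> itself are only some.\<close>

locale bounded_class_generators = group G for G (structure) +
  fixes Y :: "'a set" and n :: nat
  assumes Y_carrier: "Y \<subseteq> carrier G"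
    and Y_inv: "\<And>y. y \<in> Y \<Longrightarrow> inv y \<in> Y"
    and Y_generate: "generate G Y = carrier G"
    and Y_class: "\<And>y. y \<in> Y \<Longrightarrow>
      finite (conjugates G (carrier G) y) \<and> card (conjugates G (carrier G) y) \<le> n"
    and commutators_in_Y: "commutators G \<subseteq> Y"
begin

definition conj_closure :: "'a set \<Rightarrow> 'a set" where
  "conj_closure S = (\<Union>s \<in> S. conjugates G (carrier G) s)"

lemma conj_closure_props:
  assumes "S \<subseteq> Y" "finite S" "card S \<le> k"
  shows "conj_closed (conj_closure S)" "finite (conj_closure S)" "card (conj_closure S) \<le> k * n"
    and "S \<subseteq> conj_closure S"
proof -
  show "conj_closed (conj_closure S)"
    using assms Y_carrier unfolding conj_closed_def conj_closure_def conjugates_altdef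
    by (fastforce simp: conj_by_conj_by)
  show "finite (conj_closure S)" using assms Y_class by (auto simp: conj_closure_def)
  have "card (conj_closure S) \<le> (\<Sum>s \<in> S. card (conjugates G (carrier G) s))"
    unfolding conj_closure_def by (rule card_UN_le) fact
  also have "\<dots> \<le> card S * n" using sum_bounded_above[of S "\<lambda>s. card (conjugates G (carrier G) s)" n] assms Y_class
    by (simp add: subset_iff)
  also have "\<dots> \<le> k * n" using assms by simp
  finally show "card (conj_closure S) \<le> k * n" .
  show "S \<subseteq> conj_closure S"
  proof
    fix s assume "s \<in> S"
    moreover from this have "s = conj_by G \<one> s" using assms Y_carrier by (auto simp: conj_by_def)
    ultimately show "s \<in> conj_closure S" unfolding conj_closure_def conjugates_altdef by blast
  qed
qed

text \<open>Each of the at most \<open>k\<close> values is attained on a word of fewer than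
  \<open>k\<close> letters, by \<open>short_word_exists\<close>; the letters of these words make up
  \<open>S\<close>.\<close>

lemma short_words_cover:
  assumes fin: "finite F" "card F \<le> k" "\<phi> ` carrier G \<subseteq> F"
    and comp: "\<And>u v g. u \<in> carrier G \<Longrightarrow> v \<in> carrier G \<Longrightarrow> g \<in> carrier G \<Longrightarrow>
                \<phi> u = \<phi> v \<Longrightarrow> \<phi> (u \<otimes> g) = \<phi> (v \<otimes> g)"
  shows "\<exists>S. S \<subseteq> Y \<and> finite S \<and> card S \<le> k * k \<and>
           (\<forall>h \<in> carrier G. \<exists>w. set w \<subseteq> S \<and> \<phi> (word_prod G w) = \<phi> h)"
proof -
  have "\<forall>f \<in> \<phi> ` carrier G. \<exists>w. set w \<subseteq> Y \<and> length w < card F \<and> \<phi> (word_prod G w) = f"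
    using short_word_exists[OF Y_carrier Y_inv Y_generate fin(1,3) comp] by blast
  then obtain W where W: "\<And>f. f \<in> \<phi> ` carrier G \<Longrightarrow>
    set (W f) \<subseteq> Y \<and> length (W f) < card F \<and> \<phi> (word_prod G (W f)) = f"
    by metis
  define S where "S = (\<Union>f \<in> \<phi> ` carrier G. set (W f))"
  have fi: "finite (\<phi> ` carrier G)" "card (\<phi> ` carrier G) \<le> k"
    using fin by (auto intro: finite_subset le_trans[OF card_mono])
  have "card S \<le> (\<Sum>f \<in> \<phi> ` carrier G. card (set (W f)))"
    unfolding S_def by (rule card_UN_le[OF fi(1)])
  also have "\<dots> \<le> card (\<phi> ` carrier G) * k"
  proof -
    have "card (set (W f)) \<le> k" if "f \<in> \<phi> ` carrier G" for f
      using W[OF that] card_length[of "W f"] fin(2) by linarith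
    then show ?thesis using sum_bounded_above[of "\<phi> ` carrier G" "\<lambda>f. card (set (W f))" k] by simp
  qed
  also have "\<dots> \<le> k * k" using fi by simp
  finally have "card S \<le> k * k" .
  moreover have "S \<subseteq> Y" unfolding S_def using W by blast
  moreover have "finite S" unfolding S_def by (rule finite_UN_I[OF fi(1)]) simp
  moreover have "\<exists>w. set w \<subseteq> S \<and> \<phi> (word_prod G w) = \<phi> h" if "h \<in> carrier G" for h
    using W[of "\<phi> h"] that by (intro exI[of _ "W (\<phi> h)"]) (auto simp: S_def)
  ultimately show ?thesis by blast
qed

text \<open>Sending \<open>h\<close> to the conjugate of \<open>y\<close> by \<open>h\<close>
  separates the right cosets of the centralizer of \<open>y\<close> and takes at most
  \<open>n\<close> values.\<close>

lemma class_words_cover: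
  assumes "y \<in> Y"
  shows "\<exists>S. S \<subseteq> Y \<and> finite S \<and> card S \<le> n * n \<and>
           (\<forall>h \<in> carrier G. \<exists>w. set w \<subseteq> S \<and> conj_by G (word_prod G w) y = conj_by G h y)"
proof (rule short_words_cover)
  show "finite (conjugates G (carrier G) y)" "card (conjugates G (carrier G) y) \<le> n"
    using Y_class assms by auto
  show "(\<lambda>h. conj_by G h y) ` carrier G \<subseteq> conjugates G (carrier G) y"
    by (simp add: conjugates_altdef)
  show "conj_by G (u \<otimes> g) y = conj_by G (v \<otimes> g) y"
    if "u \<in> carrier G" "v \<in> carrier G" "g \<in> carrier G" "conj_by G u y = conj_by G v y" for u v g
    using that assms Y_carrier by (auto simp flip: conj_by_conj_by)
qed

end

text \<open>Here \<open>t\<close> bounds the number of conjugates of a generator and of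
  \<open>n * n\<close> further letters, and \<open>t ^ t\<close> the number of self-maps of this
  set, hence the index of the centre in the subgroup it generates.\<close>

definition class_commutator_bound :: "nat \<Rightarrow> nat" where
  "class_commutator_bound n = (let t = (n * n + 1) * n in schur_bound (t ^ t))"

context bounded_class_generators
begin

text \<open>
  Let \<open>U\<close> be generated by the conjugates of \<open>y\<close> and of the letters of words representing the cosets
  of the centralizer of \<open>y\<close>. Then \<open>[y, h]\<close> lies in \<open>U'\<close> for every \<open>h\<close>, and \<open>U\<close> is central-by-finite.
\<close>

lemma generator_central_mod_finite:
  assumes y: "y \<in> Y"
  shows "\<exists>N. N \<lhd> G \<and> finite N \<and> card N \<le> class_commutator_bound n \<and> y \<in> central_mod N"
proof -
  obtain S where S: "S \<subseteq> Y" "finite S" "card S \<le> n * n"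
    and cover: "\<And>h. h \<in> carrier G \<Longrightarrow> \<exists>w. set w \<subseteq> S \<and> conj_by G (word_prod G w) y = conj_by G h y"
    using class_words_cover[OF y] by blast
  define T where "T = conj_closure (insert y S)"
  define t where "t = (n * n + 1) * n"
  have "card (insert y S) \<le> n * n + 1" using S card_insert_le_m1[of "n * n + 1" S] by simp
  then have T: "conj_closed T" "finite T" "card T \<le> t" "insert y S \<subseteq> T"
    unfolding T_def t_def using S y by (intro conj_closure_props; simp)+
  have Tc: "T \<subseteq> carrier G" using T(1) by (simp add: conj_closed_def)
  define U where "U = generate G T"
  have U: "subgroup U G" unfolding U_def by (rule generate_is_subgroup[OF Tc])
  have TU: "T \<subseteq> U" unfolding U_def by (auto intro: generate.incl)
  have Unormal: "U \<lhd> G" unfolding U_def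
  proof (rule normal_generateI[OF Tc])
    fix h g assume "h \<in> T" "g \<in> carrier G"
    then have "conj_by G (inv g) h \<in> T" using T(1) by (simp add: conj_closed_def)
    then show "g \<otimes> h \<otimes> inv g \<in> T" using \<open>g \<in> carrier G\<close> by (simp add: conj_by_def)
  qed
  have Uc: "U \<subseteq> carrier G" using U subgroup.subset by blast
  have "finite (derived G U) \<and> card (derived G U) \<le> schur_bound (t ^ t)"
  \<comment> \<open>Elements of \<open>U\<close> acting alike on \<open>T\<close> differ by a factor
    that centralizes \<open>T\<close> and therefore \<open>U\<close>, which \<open>T\<close>
    generates; so the number of actions bounds the index of the centre of \<open>U\<close>.\<close>
  proof (rule schur_finite_derived[OF U, where \<phi> = "conj_action T"])
    show "finite (T \<rightarrow>\<^sub>E T)" "card (T \<rightarrow>\<^sub>E T) \<le> t ^ t" by (rule conj_action_codomain[OF T(2,3)])+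
    show "conj_action T ` U \<subseteq> T \<rightarrow>\<^sub>E T" using conj_action_in[OF T(1)] Uc by blast
    fix u v x assume uvx: "u \<in> U" "v \<in> U" "x \<in> U" "conj_action T u = conj_action T v"
    have "u \<otimes> inv v \<in> centralizer T"
      using uvx Uc by (intro conj_action_eq_centralizer[OF Tc]) auto
    then show "u \<otimes> inv v \<otimes> x = x \<otimes> (u \<otimes> inv v)"
      using commute_generate[OF Tc, of "u \<otimes> inv v" x] uvx by (auto simp: centralizer_def U_def)
  qed
  moreover have "y \<in> central_mod (derived G U)"
  proof -
    have "commutator G y h \<in> derived G U" if h: "h \<in> carrier G" for h
    proof -
      obtain w where w: "set w \<subseteq> S" "conj_by G (word_prod G w) y = conj_by G h y"
        using cover[OF h] by blast
      have wU: "word_prod G w \<in> U" using w T TU by (intro word_prod_in_subgroup[OF U]) auto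
      have yU: "y \<in> U" using T TU by auto
      \<comment> \<open>The commutator depends on \<open>h\<close> only through the conjugate of
        \<open>y\<close> by \<open>h\<close>, so \<open>h\<close> may be replaced by a word lying in
        \<open>U\<close>.\<close>
      have "commutator G y h = inv y \<otimes> conj_by G h y"
        using y Y_carrier h by (auto simp: free_group_simps)
      also have "\<dots> = inv y \<otimes> conj_by G (word_prod G w) y" by (simp add: w)
      also have "\<dots> = commutator G y (word_prod G w)"
        using subsetD[OF Uc wU] subsetD[OF Uc yU] by (simp add: free_group_simps)
      finally show ?thesis using commutator_in_derived[OF U yU wU] by simp
    qed
    then show ?thesis using y Y_carrier by (auto simp: central_mod_def)
  qed
  ultimately show ?thesis
    using derived_is_normal[OF Unormal] by (auto simp: class_commutator_bound_def Let_def t_def)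
qed

text \<open>
  The translates \<open>u a\<^sup>b\<close> over the class of \<open>a\<close> already exhaust the class of \<open>u a\<close>, because the latter
  is not larger.
\<close>

lemma translate_of_maximal_class:
  assumes a: "a \<in> commutators G"
    and max: "\<And>x. x \<in> commutators G \<Longrightarrow>
      card (conjugates G (carrier G) x) \<le> card (conjugates G (carrier G) a)"
    and cover: "\<And>h. h \<in> carrier G \<Longrightarrow> \<exists>w. set w \<subseteq> S \<and> conj_by G (word_prod G w) a = conj_by G h a"
    and S: "S \<subseteq> T" "T \<subseteq> carrier G"
    and N: "N \<lhd> G" "a \<in> central_mod N"
    and u: "u \<in> centralizer T" "u \<otimes> a \<in> commutators G"
  shows "u \<in> central_mod N"
proof -
  interpret N: normal N G by (rule N)
  have c: "a \<in> carrier G" "u \<in> carrier G" using a u commutators_in_Y Y_carrier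
    by (auto simp: centralizer_def)
  have "(\<otimes>) u ` conjugates G (carrier G) a = conjugates G (carrier G) (u \<otimes> a)"
  proof (rule card_subset_eq)
    show "finite (conjugates G (carrier G) (u \<otimes> a))" using Y_class commutators_in_Y u by blast
    show "(\<otimes>) u ` conjugates G (carrier G) a \<subseteq> conjugates G (carrier G) (u \<otimes> a)"
    proof clarify
      fix x assume "x \<in> conjugates G (carrier G) a"
      then obtain h where h: "h \<in> carrier G" "x = conj_by G h a" by (auto simp: conjugates_altdef)
      then obtain w where w: "set w \<subseteq> S" "x = conj_by G (word_prod G w) a" using cover by metis
      have wc: "word_prod G w \<in> carrier G" using w S by auto
      \<comment> \<open>All letters of \<open>w\<close> commute with \<open>u\<close>, so
        conjugation by the word fixes \<open>u\<close> and moves only the factor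
        \<open>a\<close>.\<close>
      have "word_prod G w \<in> {x \<in> carrier G. u \<otimes> x = x \<otimes> u}"
        using w S u by (intro word_prod_in_subgroup centralizer_subgroup c) (auto simp: centralizer_def)
      then have "conj_by G (word_prod G w) u = u"
        using c wc conj_by_eq_self_iff by auto
      then have "conj_by G (word_prod G w) (u \<otimes> a) = u \<otimes> x"
        using w c wc by (simp add: conj_by_mult)
      then show "u \<otimes> x \<in> conjugates G (carrier G) (u \<otimes> a)"
        unfolding conjugates_altdef using wc by (metis image_eqI)
    qed
    then have le: "card ((\<otimes>) u ` conjugates G (carrier G) a) \<le> card (conjugates G (carrier G) (u \<otimes> a))"
      using Y_class commutators_in_Y u by (intro card_mono) auto
    have "inj_on ((\<otimes>) u) (conjugates G (carrier G) a)"
      using c by (auto simp: inj_on_def conjugates_altdef)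
    then show "card ((\<otimes>) u ` conjugates G (carrier G) a) = card (conjugates G (carrier G) (u \<otimes> a))"
      using le max[OF u(2)] by (simp add: card_image)
  qed
  note translates = this
  have "commutator G u h \<in> N" if h: "h \<in> carrier G" for h
  proof -
    have "conj_by G h (u \<otimes> a) \<in> conjugates G (carrier G) (u \<otimes> a)"
      using h by (auto simp: conjugates_altdef)
    then obtain g where g: "g \<in> carrier G" "conj_by G h (u \<otimes> a) = u \<otimes> conj_by G g a"
      unfolding translates[symmetric] by (auto simp: conjugates_altdef)
    \<comment> \<open>Cancelling \<open>u\<close> leaves a quotient of two conjugates of
      \<open>a\<close>, which lies in \<open>N\<close> because \<open>a\<close> is central modulo
      \<open>N\<close>.\<close>
    have "commutator G u h = inv u \<otimes> conj_by G h (u \<otimes> a) \<otimes> inv (conj_by G h a)"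
      using c h by (simp add: free_group_simps)
    also have "\<dots> = conj_by G g a \<otimes> inv (conj_by G h a)"
      using c h g(1) unfolding g(2) by (simp add: m_assoc[symmetric])
    also have "\<dots> = conj_by G (inv a) (commutator G a g \<otimes> inv (commutator G a h))"
      using c h g(1) by (simp add: free_group_simps)
    also have "\<dots> \<in> N" using N c h g(1) by (intro conj_by_normal[OF N(1)]) (auto simp: central_mod_def)
    finally show ?thesis .
  qed
  then show ?thesis using c by (simp add: central_mod_def)
qed

end

text \<open>Here \<open>t\<close> bounds the number of conjugates of \<open>n * n\<close> letters
  and \<open>k\<close> the number of actions on them. Coset representatives of the kernel then use
  at most \<open>k * k\<close> generators; these and a commutator of largest class account for the
  exponent \<open>k * k + 1\<close>.\<close>

definition gamma3_bound_explicit :: "nat \<Rightarrow> nat" where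
  "gamma3_bound_explicit n = (let t = n * n * n; k = t ^ t in class_commutator_bound n ^ (k * k + 1))"

lemma class_commutator_bound_pos: "class_commutator_bound n > 0"
proof -
  \<comment> \<open>The summand for \<open>i = 0\<close>, which counts the empty word, equals 1 even
    when \<open>k = 0\<close>.\<close>
  have "(\<Sum>i\<le>0. (k * k) ^ i) \<le> schur_bound k" for k
    unfolding schur_bound_def by (rule sum_mono2) auto
  then have "schur_bound k > 0" for k using Suc_le_eq by simp
  then show ?thesis by (simp add: class_commutator_bound_def Let_def)
qed

lemma gamma3_bound_explicit_pos: "gamma3_bound_explicit n > 0"
  by (simp add: gamma3_bound_explicit_def Let_def class_commutator_bound_pos)

lemma (in group) lower_central_3:
  assumes "subgroup H G"
  shows "lower_central G H 3 = commutator_subgroup G (derived G H) H"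
  using derived_eq_commutator_subgroup[OF assms]
  by (simp add: lower_central_def numeral_eq_Suc)

text \<open>The third lower central term lies in one finite normal subgroup \<open>M\<close> of
  bounded order: \<open>M\<close> is chosen so that \<open>a\<close> and the generators in
  \<open>R\<close> are central modulo \<open>M\<close>, and then all commutators turn out to
  be.\<close>

lemma (in bounded_class_generators) finite_gamma3:
  "finite (lower_central G (carrier G) 3) \<and>
   card (lower_central G (carrier G) 3) \<le> gamma3_bound_explicit n"
proof -
  let ?size = "\<lambda>x. card (conjugates G (carrier G) x)"
  have "commutator G \<one> \<one> \<in> commutators G" by (auto simp: commutators_def)
  \<comment> \<open>Class sizes of commutators are at most \<open>n\<close>, hence below
    \<open>Suc n\<close>, so a largest one is attained; the trivial commutator shows that there is
    something to choose from.\<close>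
  then obtain a where a: "a \<in> commutators G" and max: "\<And>x. x \<in> commutators G \<Longrightarrow> ?size x \<le> ?size a"
    using ex_has_greatest_nat[of "\<lambda>x. x \<in> commutators G" _ ?size "Suc n"]
      Y_class commutators_in_Y by (metis in_mono less_Suc_eq_le)
  obtain d e where de: "d \<in> carrier G" "e \<in> carrier G" "a = commutator G d e"
    using a by (auto simp: commutators_def)
  have aY: "a \<in> Y" using a commutators_in_Y by auto
  obtain S where S: "S \<subseteq> Y" "finite S" "card S \<le> n * n"
    and cover: "\<And>h. h \<in> carrier G \<Longrightarrow> \<exists>w. set w \<subseteq> S \<and> conj_by G (word_prod G w) a = conj_by G h a"
    using class_words_cover[OF aY] by blast
  define T where "T = conj_closure S"
  define t where "t = n * n * n"
  define k where "k = t ^ t"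
  have T: "conj_closed T" "finite T" "card T \<le> t" "S \<subseteq> T"
    unfolding T_def t_def using S by (intro conj_closure_props; simp)+
  have Tc: "T \<subseteq> carrier G" using T(1) by (simp add: conj_closed_def)
  \<comment> \<open>Words over \<open>R\<close> represent every coset of
    \<open>centralizer T\<close>, since elements acting alike on \<open>T\<close> differ by a factor
    in it.\<close>
  have "\<exists>R. R \<subseteq> Y \<and> finite R \<and> card R \<le> k * k \<and>
    (\<forall>h \<in> carrier G. \<exists>w. set w \<subseteq> R \<and> conj_action T (word_prod G w) = conj_action T h)"
    unfolding k_def
    by (rule short_words_cover[OF conj_action_codomain[OF T(2,3)] conj_action_in[OF T(1)]
          conj_action_mult_cong[OF Tc]])
  then obtain R where R: "R \<subseteq> Y" "finite R" "card R \<le> k * k"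
    and reps: "\<And>h. h \<in> carrier G \<Longrightarrow>
      \<exists>w. set w \<subseteq> R \<and> conj_action T (word_prod G w) = conj_action T h" by blast
  \<comment> \<open>The element \<open>a\<close> joins \<open>R\<close> because
    \<open>translate_of_maximal_class\<close> needs it central modulo the same subgroup as the coset
    representatives.\<close>
  have "\<exists>M. M \<lhd> G \<and> finite M \<and> card M \<le> class_commutator_bound n ^ card (insert a R) \<and>
    insert a R \<subseteq> central_mod M"
    using R aY by (intro finite_normal_product generator_central_mod_finite) auto
  then obtain M where M: "M \<lhd> G" "finite M"
    "card M \<le> class_commutator_bound n ^ card (insert a R)" "insert a R \<subseteq> central_mod M" by blast
  have "card (insert a R) \<le> k * k + 1" using R card_insert_le_m1[of "k * k + 1" R] by simp
  then have "class_commutator_bound n ^ card (insert a R) \<le> gamma3_bound_explicit n"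
    unfolding gamma3_bound_explicit_def Let_def t_def[symmetric] k_def[symmetric]
    using class_commutator_bound_pos[of n] by (intro power_increasing) (auto simp: Suc_le_eq)
  with M(3) have "card M \<le> gamma3_bound_explicit n" by (rule le_trans)
  moreover have "lower_central G (carrier G) 3 \<subseteq> M"
  proof -
    define Z where "Z = central_mod M"
    have Z: "Z \<lhd> G" unfolding Z_def by (rule central_mod_normal[OF M(1)])
    interpret Z: normal Z G by (rule Z)
    interpret M: normal M G by (rule M(1))
    define U where "U = centralizer T"
    have U: "U \<lhd> G" unfolding U_def by (rule centralizer_normal[OF T(1)])
    interpret U: normal U G by (rule U)
    \<comment> \<open>The normal subgroup \<open>N\<close> of
      \<open>commutators_central_mod_if_translates\<close> is taken to be \<open>Z\<close>, the
      elements central modulo \<open>M\<close>.\<close>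
    have UU: "commutator G u v \<in> Z" if "u \<in> U" "v \<in> U" for u v
    proof (rule commutators_central_mod_if_translates[OF U Z de(1,2) _ that])
      fix u assume "u \<in> U" "u \<otimes> commutator G d e \<in> commutators G"
      then have u: "u \<in> centralizer T" "u \<otimes> a \<in> commutators G" by (simp_all add: U_def de(3))
      have "a \<in> central_mod M" using M(4) by simp
      from translate_of_maximal_class[OF a max cover T(4) Tc M(1) this u] show "u \<in> Z"
        unfolding Z_def .
    qed
    have split: "\<exists>u s. u \<in> U \<and> s \<in> Z \<and> h = u \<otimes> s" if h: "h \<in> carrier G" for h
    proof -
      obtain w where w: "set w \<subseteq> R" "conj_action T (word_prod G w) = conj_action T h"
        using reps[OF h] by blast
      have wZ: "word_prod G w \<in> Z" using w M
        by (intro word_prod_in_subgroup Z.subgroup_axioms) (auto simp: Z_def)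
      have "h \<otimes> inv (word_prod G w) \<in> U"
        unfolding U_def using wZ h w(2) by (intro conj_action_eq_centralizer[OF Tc]) simp_all
      then show ?thesis using wZ h
        by (intro exI[of _ "h \<otimes> inv (word_prod G w)"] exI[of _ "word_prod G w"]) (auto simp: m_assoc)
    qed
    have "commutator G g h \<in> Z" if gh: "g \<in> carrier G" "h \<in> carrier G" for g h
    proof -
      obtain u s v r where usvr: "u \<in> U" "s \<in> Z" "g = u \<otimes> s" "v \<in> U" "r \<in> Z" "h = v \<otimes> r"
        using split gh by metis
      \<comment> \<open>Both arguments are split into a part from \<open>U\<close> and a part from
        \<open>Z\<close>. Apart from the commutator of \<open>u\<close> and \<open>v\<close>, every
        commutator in the expansion has an argument \<open>s\<close> or \<open>r\<close> in the
        normal subgroup \<open>Z\<close>.\<close>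
      have "commutator G g h = conj_by G s (commutator G u r \<otimes> conj_by G r (commutator G u v))
          \<otimes> commutator G s (v \<otimes> r)"
        using usvr by (simp add: free_group_simps)
      moreover have "commutator G u r \<in> Z" "commutator G s (v \<otimes> r) \<in> Z"
        using usvr by (auto intro!: commutator_in_normal[OF Z])
      moreover have "conj_by G r (commutator G u v) \<in> Z"
        using usvr UU by (intro conj_by_normal[OF Z]) auto
      ultimately show ?thesis using usvr by (auto intro!: conj_by_normal[OF Z])
    qed
    then have "derived G (carrier G) \<subseteq> Z"
      unfolding derived_eq_commutator_subgroup[OF subgroup_self] commutator_subgroup_def
      by (intro generate_subgroup_incl Z.subgroup_axioms) auto
    then have "commutator G x h \<in> M" if "x \<in> derived G (carrier G)" "h \<in> carrier G" for x h
      using that unfolding Z_def central_mod_def by blast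
    then have "{commutator G x h | x h. x \<in> derived G (carrier G) \<and> h \<in> carrier G} \<subseteq> M" by blast
    from generate_subgroup_incl[OF this M.subgroup_axioms] show ?thesis
      unfolding lower_central_3[OF subgroup_self] commutator_subgroup_def .
  qed
  ultimately show ?thesis using M(2) by (meson card_mono finite_subset le_trans)
qed

section \<open>Transfer between groups\<close>

context group
begin

lemma commutator_consistent:
  assumes "subgroup H G" "x \<in> H" "y \<in> H"
  shows "commutator (G\<lparr>carrier := H\<rparr>) x y = commutator G x y"
  using assms by (simp add: commutator_def)

lemma conjugates_consistent:
  assumes "subgroup H G" "K \<subseteq> H"
  shows "conjugates (G\<lparr>carrier := H\<rparr>) K x = conjugates G K x"
proof -
  have "inv\<^bsub>G\<lparr>carrier := H\<rparr>\<^esub> g = inv g" if "g \<in> K" for g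
    using that assms by (intro m_inv_consistent) auto
  then show ?thesis unfolding conjugates_def by (intro Collect_cong ex_cong1) auto
qed

lemma commutators_consistent:
  assumes "subgroup H G"
  shows "commutators (G\<lparr>carrier := H\<rparr>) \<subseteq> commutators G"
proof -
  interpret H: subgroup H G by fact
  show ?thesis
  proof
    fix z assume "z \<in> commutators (G\<lparr>carrier := H\<rparr>)"
    then obtain x y where xy: "x \<in> H" "y \<in> H" "z = commutator (G\<lparr>carrier := H\<rparr>) x y"
      by (auto simp: commutators_def)
    then have "z = commutator G x y" using commutator_consistent[OF assms] by simp
    moreover have "x \<in> carrier G" "y \<in> carrier G" using xy by simp_all
    ultimately show "z \<in> commutators G" unfolding commutators_def by blast
  qed
qed

lemma commutator_subgroup_consistent:
  assumes "subgroup H G" "A \<subseteq> H" "B \<subseteq> H"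
  shows "commutator_subgroup (G\<lparr>carrier := H\<rparr>) A B = commutator_subgroup G A B"
proof -
  interpret H: subgroup H G by fact
  have "commutator (G\<lparr>carrier := H\<rparr>) h k = commutator G h k" if "h \<in> A" "k \<in> B" for h k
    using that assms by (intro commutator_consistent) auto
  then have eq: "{commutator (G\<lparr>carrier := H\<rparr>) h k | h k. h \<in> A \<and> k \<in> B} =
    {commutator G h k | h k. h \<in> A \<and> k \<in> B}"
    by (intro Collect_cong ex_cong1) auto
  have "{commutator G h k | h k. h \<in> A \<and> k \<in> B} \<subseteq> H"
    using subsetD[OF assms(2)] subsetD[OF assms(3)] by (auto simp: commutator_def)
  then show ?thesis unfolding commutator_subgroup_def eq using assms(1) by (rule generate_consistent)
qed

lemma lower_central_3_consistent:
  assumes "subgroup H G" "subgroup K G" "K \<subseteq> H"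
  shows "lower_central (G\<lparr>carrier := H\<rparr>) K 3 = lower_central G K 3"
proof -
  have "group (G\<lparr>carrier := H\<rparr>)" using assms subgroup_imp_group by blast
  moreover have "subgroup K (G\<lparr>carrier := H\<rparr>)" using assms subgroup_incl by blast
  moreover have "derived G K \<subseteq> H" using assms derived_incl by blast
  ultimately show ?thesis
    using assms by (simp add: group.lower_central_3 lower_central_3 commutator_subgroup_consistent
        derived_consistent)
qed

text \<open>The derived group, as a group in its own right, satisfies
  \<open>bounded_class_generators\<close> with the commutators of \<open>G\<close> as generators;
  they are closed under inversion because the inverse of [x, y] is [y, x].\<close>

lemma finite_gamma3_derived:
  assumes bound: "\<And>x. x \<in> commutators G \<Longrightarrow> finite (conjugates G (derived_group G) x) \<and>
    card (conjugates G (derived_group G) x) \<le> n"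
  shows "finite (lower_central G (derived_group G) 3) \<and>
    card (lower_central G (derived_group G) 3) \<le> gamma3_bound_explicit n"
proof -
  define D where "D = derived_group G"
  have D: "subgroup D G" unfolding D_def by (rule derived_is_subgroup) simp
  interpret D: subgroup D G by (rule D)
  have YD: "commutators G \<subseteq> D"
    unfolding D_def commutators_def using commutator_in_derived[OF subgroup_self] by blast
  have gen: "generate G (commutators G) = D"
    unfolding D_def derived_eq_commutator_subgroup[OF subgroup_self] commutator_subgroup_def
      commutators_def ..
  interpret DG: group "G\<lparr>carrier := D\<rparr>" by (rule subgroup_imp_group[OF D])
  interpret bounded_class_generators "G\<lparr>carrier := D\<rparr>" "commutators G" n
  proof
    show "commutators G \<subseteq> carrier (G\<lparr>carrier := D\<rparr>)" using YD by simp
    show "inv\<^bsub>G\<lparr>carrier := D\<rparr>\<^esub> y \<in> commutators G" if "y \<in> commutators G" for y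
    proof -
      from that have "inv\<^bsub>G\<lparr>carrier := D\<rparr>\<^esub> y = inv y" using m_inv_consistent[OF D] YD by blast
      then show ?thesis using that inv_commutator by (auto simp: commutators_def)
    qed
    show "generate (G\<lparr>carrier := D\<rparr>) (commutators G) = carrier (G\<lparr>carrier := D\<rparr>)"
      unfolding generate_consistent[OF YD D] gen by simp
    show "finite (conjugates (G\<lparr>carrier := D\<rparr>) (carrier (G\<lparr>carrier := D\<rparr>)) y) \<and>
      card (conjugates (G\<lparr>carrier := D\<rparr>) (carrier (G\<lparr>carrier := D\<rparr>)) y) \<le> n"
      if "y \<in> commutators G" for y
      using bound[OF that] by (simp add: conjugates_consistent[OF D] D_def[symmetric])
    show "commutators (G\<lparr>carrier := D\<rparr>) \<subseteq> commutators G" by (rule commutators_consistent[OF D])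
  qed
  show ?thesis
    using finite_gamma3 lower_central_3_consistent[OF D D order_refl] unfolding D_def[symmetric] by simp
qed

end

text \<open>The explicit function has the property by which \<open>gamma3_bound\<close> is chosen,
  so the chosen function has it too.\<close>

lemma gamma3_bound_spec:
  "(\<forall>n>0. gamma3_bound n > 0) \<and>
   (\<forall>n>0. \<forall>G :: nat monoid. group G \<longrightarrow>
      (\<forall>x \<in> commutators G. finite (conjugates G (derived_group G) x) \<and>
         card (conjugates G (derived_group G) x) \<le> n) \<longrightarrow>
      finite (lower_central G (derived_group G) 3) \<and>
      card (lower_central G (derived_group G) 3) \<le> gamma3_bound n)"
  unfolding gamma3_bound_def
proof (rule someI[of _ gamma3_bound_explicit], intro conjI allI impI)
  fix n show "gamma3_bound_explicit n > 0" by (rule gamma3_bound_explicit_pos)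
next
  fix n and G :: "nat monoid"
  assume "group G"
    "\<forall>x \<in> commutators G. finite (conjugates G (derived_group G) x) \<and>
         card (conjugates G (derived_group G) x) \<le> n"
  then show "finite (lower_central G (derived_group G) 3)"
    "card (lower_central G (derived_group G) 3) \<le> gamma3_bound_explicit n"
    using group.finite_gamma3_derived[of G n] by blast+
qed

section \<open>Transport along homomorphisms\<close>

lemma (in group_hom) commutator_img:
  "x \<in> carrier G \<Longrightarrow> y \<in> carrier G \<Longrightarrow> h (commutator G x y) = commutator H (h x) (h y)"
  by (simp add: commutator_def)

lemma (in group_hom) commutator_subgroup_img:
  assumes "A \<subseteq> carrier G" "B \<subseteq> carrier G"
  shows "commutator_subgroup H (h ` A) (h ` B) = h ` commutator_subgroup G A B"
proof -
  have hom: "commutator H (h x) (h y) = h (commutator G x y)" if "x \<in> A" "y \<in> B" for x y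
    using that assms by (simp add: commutator_img subset_iff)
  have "{commutator H x y | x y. x \<in> h ` A \<and> y \<in> h ` B} =
    h ` {commutator G x y | x y. x \<in> A \<and> y \<in> B}" (is "?L = h ` ?R")
  proof (intro equalityI subsetI)
    fix z assume "z \<in> ?L"
    then obtain x y where "x \<in> A" "y \<in> B" "z = commutator H (h x) (h y)" by blast
    then show "z \<in> h ` ?R" using hom by blast
  next
    fix z assume "z \<in> h ` ?R"
    then obtain x y where "x \<in> A" "y \<in> B" "z = h (commutator G x y)" by blast
    then show "z \<in> ?L" using hom[of x y, symmetric] by blast
  qed
  moreover have "?R \<subseteq> carrier G" using assms by blast
  ultimately show ?thesis unfolding commutator_subgroup_def by (simp add: generate_img)
qed

lemma (in group_hom) conjugates_img:
  assumes "A \<subseteq> carrier G" "x \<in> carrier G"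
  shows "conjugates H (h ` A) (h x) = h ` conjugates G A x"
proof -
  have "conj_by H (h g) (h x) = h (conj_by G g x)" if "g \<in> A" for g
    using that assms by (simp add: conj_by_def subset_iff)
  then show ?thesis
    unfolding G.conjugates_altdef H.conjugates_altdef image_image by (intro image_cong) auto
qed

lemma (in group_hom) lower_central_3_img:
  assumes "subgroup A G"
  shows "lower_central H (h ` A) 3 = h ` lower_central G A 3"
proof -
  have "subgroup (h ` A) H" "A \<subseteq> carrier G"
    using assms subgroup_img_is_subgroup subgroup.subset by auto
  moreover from this have "derived G A \<subseteq> carrier G" using G.derived_in_carrier by blast
  ultimately show ?thesis
    using assms by (simp add: G.lower_central_3 H.lower_central_3 derived_img commutator_subgroup_img)
qed

text \<open>The property of \<open>gamma3_bound\<close> concerns groups with elements in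
  \<open>nat\<close>; a countable carrier is injected into \<open>nat\<close> and the group
  structure carried along, an isomorphism that preserves all the cardinalities.\<close>

lemma (in group) gamma3_bound_countable:
  assumes count: "countable (carrier G)" and n: "n > 0"
    and bound: "\<And>x. x \<in> commutators G \<Longrightarrow> finite (conjugates G (derived_group G) x) \<and>
      card (conjugates G (derived_group G) x) \<le> n"
  shows "finite (lower_central G (derived_group G) 3) \<and>
    card (lower_central G (derived_group G) 3) \<le> gamma3_bound n"
proof -
  define h where "h = to_nat_on (carrier G)"
  define N where "N = image_group h G"
  have inj: "inj_on h (carrier G)" unfolding h_def using count by (rule inj_on_to_nat_on)
  have carN: "carrier N = h ` carrier G" by (simp add: N_def image_group_carrier)
  have iso: "h \<in> iso G N" unfolding N_def by (rule inj_imp_image_group_iso[OF inj])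
  have "group N" unfolding N_def by (rule inj_imp_image_group_is_group[OF inj])
  then interpret h: group_hom G N h
    using iso by (auto simp: group_hom_def group_hom_axioms_def iso_def)
  have D: "subgroup (derived_group G) G" by (rule derived_is_subgroup) simp
  have Dc: "derived_group G \<subseteq> carrier G" using D subgroup.subset by blast
  have DN: "derived_group N = h ` derived_group G"
    unfolding carN by (rule h.derived_img) simp
  have "finite (conjugates N (derived_group N) y) \<and> card (conjugates N (derived_group N) y) \<le> n"
    if "y \<in> commutators N" for y
  proof -
    from that obtain u v where uv: "u \<in> carrier G" "v \<in> carrier G" "y = h (commutator G u v)"
      by (auto simp: commutators_def carN h.commutator_img)
    then have "commutator G u v \<in> commutators G" by (auto simp: commutators_def)
    moreover have "conjugates N (derived_group N) y = h ` conjugates G (derived_group G) (commutator G u v)"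
      unfolding DN uv(3) by (rule h.conjugates_img[OF Dc]) (use uv in auto)
    ultimately show ?thesis using bound card_image_le le_trans by (metis finite_imageI)
  qed
  then have "finite (lower_central N (derived_group N) 3) \<and>
      card (lower_central N (derived_group N) 3) \<le> gamma3_bound n"
    using gamma3_bound_spec n \<open>group N\<close> by blast
  moreover have "lower_central N (derived_group N) 3 = h ` lower_central G (derived_group G) 3"
    unfolding DN by (rule h.lower_central_3_img[OF D])
  moreover have "inj_on h (lower_central G (derived_group G) 3)"
  proof (rule inj_on_subset[OF inj])
    show "lower_central G (derived_group G) 3 \<subseteq> carrier G"
      unfolding lower_central_3[OF D] commutator_subgroup_def
      using Dc derived_in_carrier[OF Dc] by (intro generate_incl) (auto simp: subset_iff)
  qed
  ultimately show ?thesis by (simp add: card_image finite_image_iff)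
qed

section \<open>Reduction to countable groups\<close>

text \<open>Monotone operators of finite character. They act on arbitrary sets, not only on
  subgroups, so that a finite subset of a group may be inserted.\<close>

definition finitary :: "('a set \<Rightarrow> 'a set) \<Rightarrow> bool" where
  "finitary P \<longleftrightarrow> mono P \<and> (\<forall>A. \<forall>x \<in> P A. \<exists>F. finite F \<and> F \<subseteq> A \<and> x \<in> P F)"

lemma finitary_mono: "finitary P \<Longrightarrow> A \<subseteq> B \<Longrightarrow> P A \<subseteq> P B"
  by (auto simp: finitary_def mono_def)

text \<open>An element of a commutator subgroup is a finite product of commutators and their
  inverses; each factor needs finitely many elements of \<open>A\<close>, and monotonicity allows
  passing to the union.\<close>

lemma (in group) finitary_commutator_subgroup:
  assumes P: "finitary P" and Q: "finitary Q"
  shows "finitary (\<lambda>A. commutator_subgroup G (P A) (Q A))"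
proof -
  have mono: "commutator_subgroup G (P A) (Q A) \<subseteq> commutator_subgroup G (P B) (Q B)" if "A \<subseteq> B" for A B
  proof -
    have "P A \<subseteq> P B" "Q A \<subseteq> Q B" using that P Q finitary_mono by blast+
    then show ?thesis unfolding commutator_subgroup_def by (intro mono_generate) blast
  qed
  have base: "\<exists>F. finite F \<and> F \<subseteq> A \<and> x \<in> {commutator G h k | h k. h \<in> P F \<and> k \<in> Q F}"
    if "x \<in> {commutator G h k | h k. h \<in> P A \<and> k \<in> Q A}" for A x
  proof -
    from that obtain h k where hk: "h \<in> P A" "k \<in> Q A" "x = commutator G h k" by blast
    obtain E F where EF: "finite E" "E \<subseteq> A" "h \<in> P E" "finite F" "F \<subseteq> A" "k \<in> Q F"
      using hk P Q by (meson finitary_def)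
    moreover have "P E \<subseteq> P (E \<union> F)" "Q F \<subseteq> Q (E \<union> F)"
      using finitary_mono[OF P] finitary_mono[OF Q] by simp_all
    ultimately have "h \<in> P (E \<union> F)" "k \<in> Q (E \<union> F)" "finite (E \<union> F)" "E \<union> F \<subseteq> A" by auto
    then show ?thesis using hk(3) by blast
  qed
  have "\<exists>F. finite F \<and> F \<subseteq> A \<and> x \<in> commutator_subgroup G (P F) (Q F)"
    if "x \<in> commutator_subgroup G (P A) (Q A)" for A x
    using that unfolding commutator_subgroup_def
  proof induction
    case one
    then show ?case by (intro exI[of _ "{}"]) (auto intro: generate.one)
  next
    case (incl x)
    from base[OF this] show ?case by (meson generate.incl)
  next
    case (inv x)
    from base[OF this] show ?case by (meson generate.inv)
  next
    case (eng x y)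
    then obtain E F where EF: "finite E" "E \<subseteq> A" "finite F" "F \<subseteq> A"
      and xy: "x \<in> commutator_subgroup G (P E) (Q E)" "y \<in> commutator_subgroup G (P F) (Q F)"
      unfolding commutator_subgroup_def by blast
    have "x \<in> commutator_subgroup G (P (E \<union> F)) (Q (E \<union> F))"
      "y \<in> commutator_subgroup G (P (E \<union> F)) (Q (E \<union> F))"
      using xy mono[of E "E \<union> F"] mono[of F "E \<union> F"] by auto
    then have "x \<otimes> y \<in> commutator_subgroup G (P (E \<union> F)) (Q (E \<union> F))"
      unfolding commutator_subgroup_def by (rule generate.eng)
    then show ?case using EF unfolding commutator_subgroup_def by (intro exI[of _ "E \<union> F"]) auto
  qed
  then show ?thesis using mono by (auto simp: finitary_def mono_def)
qed

lemma finitary_finite_subset: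
  assumes P: "finitary P" and "finite X" "X \<subseteq> P A"
  shows "\<exists>F. finite F \<and> F \<subseteq> A \<and> X \<subseteq> P F"
  using assms(2,3)
proof (induction X rule: finite_induct)
  case empty
  then show ?case by (intro exI[of _ "{}"]) auto
next
  case (insert x X)
  then obtain E F where EF: "finite E" "E \<subseteq> A" "X \<subseteq> P E" "finite F" "F \<subseteq> A" "x \<in> P F"
    using P unfolding finitary_def by (metis insert_subset)
  moreover have "P E \<subseteq> P (E \<union> F)" "P F \<subseteq> P (E \<union> F)"
    using finitary_mono[OF P] by simp_all
  ultimately show ?case by (intro exI[of _ "E \<union> F"]) auto
qed

text \<open>Adding inverses keeps the set countable, and a countable alphabet has only countably
  many words.\<close>

lemma (in group) countable_subgroup_exists:
  assumes "countable A" "A \<subseteq> carrier G"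
  shows "\<exists>K. subgroup K G \<and> countable K \<and> A \<subseteq> K"
proof -
  define B where "B = A \<union> m_inv G ` A"
  have B: "B \<subseteq> carrier G" "\<And>b. b \<in> B \<Longrightarrow> inv b \<in> B" "countable B"
    using assms by (auto simp: B_def subset_iff)
  have "generate G B = word_prod G ` {w. set w \<subseteq> B}" by (rule generate_eq_word_prod[OF B(1,2)])
  then have "countable (generate G B)" using countable_lists[OF B(3)] by (simp add: lists_eq_set)
  moreover have "A \<subseteq> generate G B" by (auto simp: B_def intro: generate.incl)
  ultimately show ?thesis using generate_is_subgroup[OF B(1)] by blast
qed

text \<open>A finite set of elements of the third term already lies in the corresponding term for a
  countable subgroup \<open>K\<close>, to which the hypothesis passes. The countable case bounds the
  size of every such finite set, and hence of the whole term.\<close>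

theorem theorem1p2:
  shows "\<exists>f :: nat \<Rightarrow> nat. f = gamma3_bound \<and>
    (\<forall>n>0. f n > 0) \<and>
    (\<forall>n>0. \<forall>G :: ('a, 'b) monoid_scheme.
       group G \<longrightarrow>
       (\<forall>x \<in> commutators G. finite (conjugates G (derived_group G) x) \<and>
          card (conjugates G (derived_group G) x) \<le> n) \<longrightarrow>
       finite (lower_central G (derived_group G) 3) \<and>
       card (lower_central G (derived_group G) 3) \<le> f n)"
proof (rule exI[of _ gamma3_bound], intro conjI[OF refl] conjI allI impI)
  fix n :: nat assume "n > 0"
  then show "gamma3_bound n > 0" using gamma3_bound_spec by blast
next
  fix n :: nat and G :: "('a, 'b) monoid_scheme"
  assume n: "n > 0" and "group G"
    and bound: "\<forall>x \<in> commutators G. finite (conjugates G (derived_group G) x) \<and>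
      card (conjugates G (derived_group G) x) \<le> n"
  interpret group G by fact
  \<comment> \<open>On a subgroup \<open>A\<close> this is the third lower central term of the
    derived group of \<open>A\<close>; written with commutator subgroups alone, it is visibly
    finitary on arbitrary subsets.\<close>
  define P where "P A = commutator_subgroup G (commutator_subgroup G (commutator_subgroup G A A)
    (commutator_subgroup G A A)) (commutator_subgroup G A A)" for A
  have "finitary (\<lambda>A :: 'a set. A)" by (auto simp: finitary_def mono_def)
  then have P: "finitary P"
    unfolding P_def by (intro finitary_commutator_subgroup)
  have P_gamma3: "P A = lower_central G (derived G A) 3" if "subgroup A G" for A
  proof -
    have "subgroup (derived G A) G" using that by (intro derived_is_subgroup subgroup.subset)
    then show ?thesis using that
      by (simp add: P_def lower_central_3 derived_eq_commutator_subgroup)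
  qed
  have "card X \<le> gamma3_bound n" if X: "X \<subseteq> P (carrier G)" "finite X" for X
  proof -
    obtain F where F: "finite F" "F \<subseteq> carrier G" "X \<subseteq> P F"
      using finitary_finite_subset[OF P X(2,1)] by blast
    obtain K where K: "subgroup K G" "countable K" "F \<subseteq> K"
      using countable_subgroup_exists[OF countable_finite[OF F(1)] F(2)] by blast
    interpret K: subgroup K G by (rule K)
    interpret KG: group "G\<lparr>carrier := K\<rparr>" by (rule subgroup_imp_group[OF K(1)])
    have DK: "derived_group (G\<lparr>carrier := K\<rparr>) = derived G K"
      using derived_consistent[of K K] K by simp
    have sub: "derived G K \<subseteq> K" "derived G K \<subseteq> derived_group G" "subgroup (derived G K) G"
      using derived_incl[of K K] mono_derived[of K "carrier G"] derived_is_subgroup[of K] K K.subset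
      by auto
    have "finite (conjugates (G\<lparr>carrier := K\<rparr>) (derived_group (G\<lparr>carrier := K\<rparr>)) x) \<and>
      card (conjugates (G\<lparr>carrier := K\<rparr>) (derived_group (G\<lparr>carrier := K\<rparr>)) x) \<le> n"
      if "x \<in> commutators (G\<lparr>carrier := K\<rparr>)" for x
    proof -
      \<comment> \<open>The derived group of \<open>K\<close> lies in that of \<open>G\<close>, so
        the classes under it can only shrink.\<close>
      have "conjugates (G\<lparr>carrier := K\<rparr>) (derived_group (G\<lparr>carrier := K\<rparr>)) x
        \<subseteq> conjugates G (derived_group G) x"
        unfolding DK conjugates_consistent[OF K(1) sub(1)] conjugates_altdef using sub(2) by auto
      moreover have "x \<in> commutators G" using that commutators_consistent[OF K(1)] by blast
      ultimately show ?thesis using bound by (meson card_mono finite_subset le_trans)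
    qed
    then have "finite (lower_central (G\<lparr>carrier := K\<rparr>) (derived G K) 3) \<and>
      card (lower_central (G\<lparr>carrier := K\<rparr>) (derived G K) 3) \<le> gamma3_bound n"
      using KG.gamma3_bound_countable[OF _ n] K(2) unfolding DK by simp
    then have "finite (P K) \<and> card (P K) \<le> gamma3_bound n"
      using lower_central_3_consistent[OF K(1) sub(3,1)] P_gamma3[OF K(1)] by simp
    moreover have "X \<subseteq> P K" using F(3) finitary_mono[OF P K(3)] by blast
    ultimately show ?thesis by (meson card_mono le_trans)
  qed
  then have "finite (P (carrier G)) \<and> card (P (carrier G)) \<le> gamma3_bound n"
    by (rule finite_if_finite_subsets_card_bdd)
  then show "finite (lower_central G (derived_group G) 3)"
    "card (lower_central G (derived_group G) 3) \<le> gamma3_bound n"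
    unfolding P_gamma3[OF subgroup_self] by auto
qed

end
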